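(* Let $\mathbb K$ be a field, let $$E=(f,k):\ B\xrightarrow{\,k\,}E\xrightarrow{\,f\,}C,\qquad E'=(f',k'):\ B'\xrightarrow{\,k'\,}E'\xrightarrow{\,f'\,}C'$$ be two singular extensions of unital associative $\mathbb K$-algebras, and let $(\varphi_0,\varphi_1)\colon(C,B)\to(C',B')$ be a morphism between the induced bimodules. Then: (i) There exist morphisms of extensions $E\to E'$ which induce $(\varphi_0,\varphi_1)$ if and only if $\varphi_0^*E'\cong\varphi_{1*}E$ as extensions of $C$ by $B'$ (by an isomorphism that is the identity on $B'$ and on $C$). (ii) In this case, the set $\mathsf{OPEXT}_{(\varphi_0,\varphi_1)}(E,E')$ of morphisms of extensions $E\to E'$ inducing $(\varphi_0,\varphi_1)$ is a simply transitive $\mathcal Z^1_H(C,B')$-set, where the $C$-bimodule structure on $B'$ is induced by the $C'$-bimodule structure via $\varphi_0$.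
   Context: A bimodule $B$ over a unital associative $\mathbb K$-algebra $C$ is a $\mathbb K$-vector space with left and right unital ($\mathbb K$-bilinear) $C$-actions such that $(c*b)*c'=c*(b*c')$. A morphism $(\varphi_0,\varphi_1)\colon(C,B)\to(C',B')$ of bimodules consists of a morphism $\varphi_0\colon C\to C'$ of unital algebras and a $\mathbb K$-linear map $\varphi_1\colon B\to B'$ with $\varphi_1(c*b)=\varphi_0(c)*\varphi_1(b)$ and $\varphi_1(b*c)=\varphi_1(b)*\varphi_0(c)$. A singular extension is a surjective morphism $f\colon E\to C$ of unital associative $\mathbb K$-algebras with kernel $k\colon B\to E$ such that $k(B)^2=0$; it induces a $C$-bimodule structure on $B$ by $k(f(e)*b)=e\,k(b)$, $k(b*f(e))=k(b)\,e$. A morphism of extensions $E\to E'$ is a morphism of short exact sequences whose components $E\to E'$ and $C\to C'$ are unital algebra morphisms; it induces the pair of its components $\varphi_0\colon C\to C'$ and $\varphi_1\colon B\to B'$. $\varphi_0^*E'$ is the extension $B'\to E'\times_{C'}C\to C$ obtained by pulling back $f'$ along $\varphi_0$. Regard $B'$ as a $C$-bimodule via $\varphi_0$. $\varphi_{1*}E$ is the push forward of $E$ along the map of $C$-bimodules $\varphi_1\colon B\to B'$, i.e. the codomain of an opcartesian lifting of $\varphi_1$ at $E$ (for the functor from singular extensions of $C$, with morphisms that are the identity on $C$, to $C$-bimodules): explicitly $B'\to(B'\rtimes E)/\{(-\varphi_1(b),k(b)):b\in B\}\to C$, where $B'\rtimes E$ is the semidirect sum with $E$ acting on $B'$ through $f$.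 $\mathcal Z^1_H(C,B')$ is the group (under addition) of crossed homomorphisms (Hochschild 1-cocycles), i.e. $\mathbb K$-linear maps $\sigma\colon C\to B'$ with $\sigma(cc')=c*\sigma(c')+\sigma(c)*c'$. A simply transitive $\Gamma$-set is a set on which the group $\Gamma$ acts so that for any two elements exactly one group element carries the first to the second. *)

theory Defs
  imports "HOL-Algebra.Module" "HOL-Algebra.QuotRing" "HOL-Algebra.Group_Action"
begin

section \<open>Algebras, linear maps and bimodules\<close>

text \<open>
  The locale \<^locale>\<open>algebra\<close> of the library is about commutative algebras only, hence the
  following one. A vector space is a \<^locale>\<open>module\<close> over a field; the multiplication and unit
  fields which its record carries are ignored.
\<close>

locale unital_algebra = module K A + A: ring A for K (structure) and A (structure) +
  assumes smult_mult_left: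
      "\<lbrakk>a \<in> carrier K; x \<in> carrier A; y \<in> carrier A\<rbrakk>
        \<Longrightarrow> (a \<odot>\<^bsub>A\<^esub> x) \<otimes>\<^bsub>A\<^esub> y = a \<odot>\<^bsub>A\<^esub> (x \<otimes>\<^bsub>A\<^esub> y)"
    and smult_mult_right:
      "\<lbrakk>a \<in> carrier K; x \<in> carrier A; y \<in> carrier A\<rbrakk>
        \<Longrightarrow> x \<otimes>\<^bsub>A\<^esub> (a \<odot>\<^bsub>A\<^esub> y) = a \<odot>\<^bsub>A\<^esub> (x \<otimes>\<^bsub>A\<^esub> y)"

definition linear_maps ::
  "('k, 'n) ring_scheme \<Rightarrow> ('k, 'a, 'p) module_scheme \<Rightarrow> ('k, 'b, 'q) module_scheme \<Rightarrow> ('a \<Rightarrow> 'b) set"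
  where "linear_maps K M N =
    {h \<in> hom (add_monoid M) (add_monoid N).
      \<forall>a \<in> carrier K. \<forall>x \<in> carrier M. h (a \<odot>\<^bsub>M\<^esub> x) = a \<odot>\<^bsub>N\<^esub> h x}"

definition algebra_homs ::
  "('k, 'n) ring_scheme \<Rightarrow> ('k, 'a, 'p) module_scheme \<Rightarrow> ('k, 'b, 'q) module_scheme \<Rightarrow> ('a \<Rightarrow> 'b) set"
  where "algebra_homs K A B = ring_hom A B \<inter> linear_maps K A B"

locale bimodule = C: unital_algebra K C + B: module K B
  for K :: "('k, 'n) ring_scheme" (structure)
    and C :: "('k, 'c) module" (structure) and B :: "('k, 'b) module" (structure) +
  fixes l :: "'c \<Rightarrow> 'b \<Rightarrow> 'b" and r :: "'b \<Rightarrow> 'c \<Rightarrow> 'b"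
  assumes l_linear: "c \<in> carrier C \<Longrightarrow> l c \<in> linear_maps K B B"
    and l_linear': "b \<in> carrier B \<Longrightarrow> (\<lambda>c. l c b) \<in> linear_maps K C B"
    and r_linear: "c \<in> carrier C \<Longrightarrow> (\<lambda>b. r b c) \<in> linear_maps K B B"
    and r_linear': "b \<in> carrier B \<Longrightarrow> r b \<in> linear_maps K C B"
    and l_one: "b \<in> carrier B \<Longrightarrow> l \<one>\<^bsub>C\<^esub> b = b"
    and r_one: "b \<in> carrier B \<Longrightarrow> r b \<one>\<^bsub>C\<^esub> = b"
    and l_mult: "\<lbrakk>c \<in> carrier C; c' \<in> carrier C; b \<in> carrier B\<rbrakk> \<Longrightarrow> l (c \<otimes>\<^bsub>C\<^esub> c') b = l c (l c' b)"
    and r_mult: "\<lbrakk>c \<in> carrier C; c' \<in> carrier C; b \<in> carrier B\<rbrakk> \<Longrightarrow> r b (c \<otimes>\<^bsub>C\<^esub> c') = r (r b c) c'"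
    and l_r: "\<lbrakk>c \<in> carrier C; c' \<in> carrier C; b \<in> carrier B\<rbrakk> \<Longrightarrow> r (l c b) c' = l c (r b c')"

definition bimodule_morphism ::
  "('k, 'n) ring_scheme
    \<Rightarrow> ('k, 'c) module \<Rightarrow> ('k, 'b) module \<Rightarrow> ('c \<Rightarrow> 'b \<Rightarrow> 'b) \<Rightarrow> ('b \<Rightarrow> 'c \<Rightarrow> 'b)
    \<Rightarrow> ('k, 'd) module \<Rightarrow> ('k, 'a) module \<Rightarrow> ('d \<Rightarrow> 'a \<Rightarrow> 'a) \<Rightarrow> ('a \<Rightarrow> 'd \<Rightarrow> 'a)
    \<Rightarrow> ('c \<Rightarrow> 'd) \<Rightarrow> ('b \<Rightarrow> 'a) \<Rightarrow> bool"
  where "bimodule_morphism K C B l r C' B' l' r' \<phi>\<^sub>0 \<phi>\<^sub>1 \<longleftrightarrow>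
    \<phi>\<^sub>0 \<in> algebra_homs K C C' \<and> \<phi>\<^sub>1 \<in> linear_maps K B B' \<and>
    (\<forall>c \<in> carrier C. \<forall>b \<in> carrier B.
      \<phi>\<^sub>1 (l c b) = l' (\<phi>\<^sub>0 c) (\<phi>\<^sub>1 b) \<and> \<phi>\<^sub>1 (r b c) = r' (\<phi>\<^sub>1 b) (\<phi>\<^sub>0 c))"


section \<open>Singular extensions\<close>

record ('k, 'b, 'e, 'c) extension =
  ext_ker :: "('k, 'b) module"
  ext_alg :: "('k, 'e) module"
  ext_base :: "('k, 'c) module"
  ext_incl :: "'b \<Rightarrow> 'e"
  ext_proj :: "'e \<Rightarrow> 'c"

locale singular_extension = field K for K :: "('k, 'n) ring_scheme" (structure) +
  fixes \<E> :: "('k, 'b, 'e, 'c) extension"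
  assumes ker_module: "module K (ext_ker \<E>)"
    and alg_algebra: "unital_algebra K (ext_alg \<E>)"
    and base_algebra: "unital_algebra K (ext_base \<E>)"
    and proj_hom: "ext_proj \<E> \<in> algebra_homs K (ext_alg \<E>) (ext_base \<E>)"
    and proj_surj: "ext_proj \<E> ` carrier (ext_alg \<E>) = carrier (ext_base \<E>)"
    and incl_linear: "ext_incl \<E> \<in> linear_maps K (ext_ker \<E>) (ext_alg \<E>)"
    and incl_inj: "inj_on (ext_incl \<E>) (carrier (ext_ker \<E>))"
    and exact: "ext_incl \<E> ` carrier (ext_ker \<E>) = a_kernel (ext_alg \<E>) (ext_base \<E>) (ext_proj \<E>)"
    and square_zero:
      "\<lbrakk>b \<in> carrier (ext_ker \<E>); b' \<in> carrier (ext_ker \<E>)\<rbrakk>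
        \<Longrightarrow> ext_incl \<E> b \<otimes>\<^bsub>ext_alg \<E>\<^esub> ext_incl \<E> b' = \<zero>\<^bsub>ext_alg \<E>\<^esub>"

text \<open>
  The induced actions of the base on the kernel; the lemmas \<open>incl_left_act\<close>, \<open>incl_right_act\<close>
  and \<open>induced_bimodule\<close> below show that the descriptions are proper.
\<close>

definition left_act :: "('k, 'b, 'e, 'c) extension \<Rightarrow> 'c \<Rightarrow> 'b \<Rightarrow> 'b"
  where "left_act \<E> c b = (THE x. x \<in> carrier (ext_ker \<E>) \<and>
    (\<forall>e \<in> carrier (ext_alg \<E>). ext_proj \<E> e = c \<longrightarrow>
      ext_incl \<E> x = e \<otimes>\<^bsub>ext_alg \<E>\<^esub> ext_incl \<E> b))"

definition right_act :: "('k, 'b, 'e, 'c) extension \<Rightarrow> 'b \<Rightarrow> 'c \<Rightarrow> 'b"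
  where "right_act \<E> b c = (THE x. x \<in> carrier (ext_ker \<E>) \<and>
    (\<forall>e \<in> carrier (ext_alg \<E>). ext_proj \<E> e = c \<longrightarrow>
      ext_incl \<E> x = ext_incl \<E> b \<otimes>\<^bsub>ext_alg \<E>\<^esub> e))"


subsection \<open>The induced bimodule\<close>

lemma linear_maps_iff:
  "h \<in> linear_maps K M N \<longleftrightarrow>
    (\<forall>x \<in> carrier M. h x \<in> carrier N) \<and>
    (\<forall>x \<in> carrier M. \<forall>y \<in> carrier M. h (x \<oplus>\<^bsub>M\<^esub> y) = h x \<oplus>\<^bsub>N\<^esub> h y) \<and>
    (\<forall>a \<in> carrier K. \<forall>x \<in> carrier M. h (a \<odot>\<^bsub>M\<^esub> x) = a \<odot>\<^bsub>N\<^esub> h x)"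
  by (auto simp: linear_maps_def hom_def Pi_iff)

lemma algebra_homs_iff:
  "h \<in> algebra_homs K M N \<longleftrightarrow>
    h \<in> linear_maps K M N \<and> h \<one>\<^bsub>M\<^esub> = \<one>\<^bsub>N\<^esub> \<and>
    (\<forall>x \<in> carrier M. \<forall>y \<in> carrier M. h (x \<otimes>\<^bsub>M\<^esub> y) = h x \<otimes>\<^bsub>N\<^esub> h y)"
  by (auto simp: algebra_homs_def linear_maps_iff ring_hom_def Pi_iff)

context singular_extension
begin

interpretation B: module K "ext_ker \<E>" by (rule ker_module)
interpretation E: unital_algebra K "ext_alg \<E>" by (rule alg_algebra)
interpretation C: unital_algebra K "ext_base \<E>" by (rule base_algebra)

lemma incl_closed: "b \<in> carrier (ext_ker \<E>) \<Longrightarrow> ext_incl \<E> b \<in> carrier (ext_alg \<E>)"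
  using incl_linear by (simp add: linear_maps_iff)

lemma proj_closed: "e \<in> carrier (ext_alg \<E>) \<Longrightarrow> ext_proj \<E> e \<in> carrier (ext_base \<E>)"
  using proj_hom by (simp add: algebra_homs_iff linear_maps_iff)

lemma proj_simps:
  assumes "e \<in> carrier (ext_alg \<E>)" "e' \<in> carrier (ext_alg \<E>)"
  shows "ext_proj \<E> (e \<oplus>\<^bsub>ext_alg \<E>\<^esub> e') = ext_proj \<E> e \<oplus>\<^bsub>ext_base \<E>\<^esub> ext_proj \<E> e'"
    and "ext_proj \<E> (e \<otimes>\<^bsub>ext_alg \<E>\<^esub> e') = ext_proj \<E> e \<otimes>\<^bsub>ext_base \<E>\<^esub> ext_proj \<E> e'"
    and "ext_proj \<E> \<one>\<^bsub>ext_alg \<E>\<^esub> = \<one>\<^bsub>ext_base \<E>\<^esub>"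
    and "a \<in> carrier K \<Longrightarrow> ext_proj \<E> (a \<odot>\<^bsub>ext_alg \<E>\<^esub> e) = a \<odot>\<^bsub>ext_base \<E>\<^esub> ext_proj \<E> e"
  using assms proj_hom by (simp_all add: algebra_homs_iff linear_maps_iff)

lemma incl_simps:
  assumes "b \<in> carrier (ext_ker \<E>)" "b' \<in> carrier (ext_ker \<E>)"
  shows "ext_incl \<E> (b \<oplus>\<^bsub>ext_ker \<E>\<^esub> b') = ext_incl \<E> b \<oplus>\<^bsub>ext_alg \<E>\<^esub> ext_incl \<E> b'"
    and "a \<in> carrier K \<Longrightarrow> ext_incl \<E> (a \<odot>\<^bsub>ext_ker \<E>\<^esub> b) = a \<odot>\<^bsub>ext_alg \<E>\<^esub> ext_incl \<E> b"
  using assms incl_linear by (simp_all add: linear_maps_iff)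

lemma proj_ring_hom: "ring_hom_ring (ext_alg \<E>) (ext_base \<E>) (ext_proj \<E>)"
  using proj_hom by (intro ring_hom_ringI2) (auto simp: algebra_homs_def E.A.ring_axioms C.A.ring_axioms)

lemma ker_ideal: "ideal (a_kernel (ext_alg \<E>) (ext_base \<E>) (ext_proj \<E>)) (ext_alg \<E>)"
  by (rule ring_hom_ring.kernel_is_ideal[OF proj_ring_hom])

lemma incl_mem_ker: "b \<in> carrier (ext_ker \<E>) \<Longrightarrow>
  ext_incl \<E> b \<in> a_kernel (ext_alg \<E>) (ext_base \<E>) (ext_proj \<E>)"
  using exact by blast

lemma incl_eq_iff: "\<lbrakk>b \<in> carrier (ext_ker \<E>); b' \<in> carrier (ext_ker \<E>)\<rbrakk> \<Longrightarrow>
  ext_incl \<E> b = ext_incl \<E> b' \<longleftrightarrow> b = b'"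
  using incl_inj by (auto dest: inj_onD)

lemma same_proj:
  assumes "e \<in> carrier (ext_alg \<E>)" "e' \<in> carrier (ext_alg \<E>)" "ext_proj \<E> e = ext_proj \<E> e'"
  obtains b where "b \<in> carrier (ext_ker \<E>)" "e' = e \<oplus>\<^bsub>ext_alg \<E>\<^esub> ext_incl \<E> b"
proof -
  interpret f: ring_hom_ring "ext_alg \<E>" "ext_base \<E>" "ext_proj \<E>" by (rule proj_ring_hom)
  have "ext_proj \<E> (\<ominus>\<^bsub>ext_alg \<E>\<^esub> e \<oplus>\<^bsub>ext_alg \<E>\<^esub> e') = \<zero>\<^bsub>ext_base \<E>\<^esub>"
    unfolding f.hom_add[OF E.M.a_inv_closed[OF assms(1)] assms(2)] f.hom_a_inv[OF assms(1)] assms(3)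
    by (rule C.M.l_neg[OF proj_closed[OF assms(2)]])
  then have "\<ominus>\<^bsub>ext_alg \<E>\<^esub> e \<oplus>\<^bsub>ext_alg \<E>\<^esub> e' \<in> ext_incl \<E> ` carrier (ext_ker \<E>)"
    unfolding exact a_kernel_def' using E.M.a_closed[OF E.M.a_inv_closed[OF assms(1)] assms(2)] by blast
  then obtain b where "b \<in> carrier (ext_ker \<E>)" "\<ominus>\<^bsub>ext_alg \<E>\<^esub> e \<oplus>\<^bsub>ext_alg \<E>\<^esub> e' = ext_incl \<E> b"
    by auto
  moreover from this(2)[symmetric] have "e' = e \<oplus>\<^bsub>ext_alg \<E>\<^esub> ext_incl \<E> b"
    using E.M.r_neg2[OF assms(1,2)] by argo
  ultimately show thesis using that by blast
qed

lemma mult_incl_cong: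
  assumes "e \<in> carrier (ext_alg \<E>)" "e' \<in> carrier (ext_alg \<E>)" "ext_proj \<E> e = ext_proj \<E> e'"
    "b \<in> carrier (ext_ker \<E>)"
  shows "e' \<otimes>\<^bsub>ext_alg \<E>\<^esub> ext_incl \<E> b = e \<otimes>\<^bsub>ext_alg \<E>\<^esub> ext_incl \<E> b"
    and "ext_incl \<E> b \<otimes>\<^bsub>ext_alg \<E>\<^esub> e' = ext_incl \<E> b \<otimes>\<^bsub>ext_alg \<E>\<^esub> e"
proof -
  obtain b' where b': "b' \<in> carrier (ext_ker \<E>)" "e' = e \<oplus>\<^bsub>ext_alg \<E>\<^esub> ext_incl \<E> b'"
    using same_proj[OF assms(1-3)] by blast
  show "e' \<otimes>\<^bsub>ext_alg \<E>\<^esub> ext_incl \<E> b = e \<otimes>\<^bsub>ext_alg \<E>\<^esub> ext_incl \<E> b"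
    using assms(1,4) b'(1) by (simp add: b'(2) E.A.l_distr incl_closed square_zero)
  show "ext_incl \<E> b \<otimes>\<^bsub>ext_alg \<E>\<^esub> e' = ext_incl \<E> b \<otimes>\<^bsub>ext_alg \<E>\<^esub> e"
    using assms(1,4) b'(1) by (simp add: b'(2) E.A.r_distr incl_closed square_zero)
qed

lemma left_act_spec:
  assumes "e \<in> carrier (ext_alg \<E>)" "b \<in> carrier (ext_ker \<E>)"
  shows "left_act \<E> (ext_proj \<E> e) b \<in> carrier (ext_ker \<E>) \<and>
    ext_incl \<E> (left_act \<E> (ext_proj \<E> e) b) = e \<otimes>\<^bsub>ext_alg \<E>\<^esub> ext_incl \<E> b"
proof -
  have "e \<otimes>\<^bsub>ext_alg \<E>\<^esub> ext_incl \<E> b \<in> ext_incl \<E> ` carrier (ext_ker \<E>)"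
    unfolding exact using ideal.I_l_closed[OF ker_ideal] incl_mem_ker assms by blast
  then obtain x where x: "x \<in> carrier (ext_ker \<E>)" "ext_incl \<E> x = e \<otimes>\<^bsub>ext_alg \<E>\<^esub> ext_incl \<E> b"
    by auto
  have "left_act \<E> (ext_proj \<E> e) b = x"
    unfolding left_act_def
  proof (rule the_equality)
    show "x \<in> carrier (ext_ker \<E>) \<and> (\<forall>e'\<in>carrier (ext_alg \<E>). ext_proj \<E> e' = ext_proj \<E> e \<longrightarrow>
        ext_incl \<E> x = e' \<otimes>\<^bsub>ext_alg \<E>\<^esub> ext_incl \<E> b)"
      using x(1) unfolding x(2)
      by (intro conjI ballI impI mult_incl_cong(1)[symmetric]) (simp_all add: assms)
  next
    fix y assume "y \<in> carrier (ext_ker \<E>) \<and> (\<forall>e'\<in>carrier (ext_alg \<E>). ext_proj \<E> e' = ext_proj \<E> e \<longrightarrow>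
        ext_incl \<E> y = e' \<otimes>\<^bsub>ext_alg \<E>\<^esub> ext_incl \<E> b)"
    then have "y \<in> carrier (ext_ker \<E>)" "ext_incl \<E> y = ext_incl \<E> x"
      unfolding x(2) using assms(1) by blast+
    with x(1) show "y = x" by (simp add: incl_eq_iff)
  qed
  then show ?thesis using x by blast
qed

lemma right_act_spec:
  assumes "e \<in> carrier (ext_alg \<E>)" "b \<in> carrier (ext_ker \<E>)"
  shows "right_act \<E> b (ext_proj \<E> e) \<in> carrier (ext_ker \<E>) \<and>
    ext_incl \<E> (right_act \<E> b (ext_proj \<E> e)) = ext_incl \<E> b \<otimes>\<^bsub>ext_alg \<E>\<^esub> e"
proof -
  have "ext_incl \<E> b \<otimes>\<^bsub>ext_alg \<E>\<^esub> e \<in> ext_incl \<E> ` carrier (ext_ker \<E>)"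
    unfolding exact using ideal.I_r_closed[OF ker_ideal] incl_mem_ker assms by blast
  then obtain x where x: "x \<in> carrier (ext_ker \<E>)" "ext_incl \<E> x = ext_incl \<E> b \<otimes>\<^bsub>ext_alg \<E>\<^esub> e"
    by auto
  have "right_act \<E> b (ext_proj \<E> e) = x"
    unfolding right_act_def
  proof (rule the_equality)
    show "x \<in> carrier (ext_ker \<E>) \<and> (\<forall>e'\<in>carrier (ext_alg \<E>). ext_proj \<E> e' = ext_proj \<E> e \<longrightarrow>
        ext_incl \<E> x = ext_incl \<E> b \<otimes>\<^bsub>ext_alg \<E>\<^esub> e')"
      using x(1) unfolding x(2)
      by (intro conjI ballI impI mult_incl_cong(2)[symmetric]) (simp_all add: assms)
  next
    fix y assume "y \<in> carrier (ext_ker \<E>) \<and> (\<forall>e'\<in>carrier (ext_alg \<E>). ext_proj \<E> e' = ext_proj \<E> e \<longrightarrow>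
        ext_incl \<E> y = ext_incl \<E> b \<otimes>\<^bsub>ext_alg \<E>\<^esub> e')"
    then have "y \<in> carrier (ext_ker \<E>)" "ext_incl \<E> y = ext_incl \<E> x"
      unfolding x(2) using assms(1) by blast+
    with x(1) show "y = x" by (simp add: incl_eq_iff)
  qed
  then show ?thesis using x by blast
qed

lemmas left_act_closed = left_act_spec[THEN conjunct1]
  and incl_left_act = left_act_spec[THEN conjunct2]
  and right_act_closed = right_act_spec[THEN conjunct1]
  and incl_right_act = right_act_spec[THEN conjunct2]

lemma base_elem:
  assumes "c \<in> carrier (ext_base \<E>)"
  obtains e where "e \<in> carrier (ext_alg \<E>)" "c = ext_proj \<E> e"
  using assms proj_surj by (metis imageE)

lemma base_ball:
  "(\<forall>c \<in> carrier (ext_base \<E>). P c) \<longleftrightarrow> (\<forall>e \<in> carrier (ext_alg \<E>). P (ext_proj \<E> e))"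
  by (metis base_elem proj_closed)

lemma ker_eqI:
  "\<lbrakk>ext_incl \<E> b = ext_incl \<E> b'; b \<in> carrier (ext_ker \<E>); b' \<in> carrier (ext_ker \<E>)\<rbrakk> \<Longrightarrow> b = b'"
  by (simp add: incl_eq_iff)

lemma induced_bimodule:
  "bimodule K (ext_base \<E>) (ext_ker \<E>) (left_act \<E>) (right_act \<E>)"
proof -
  note s = linear_maps_iff base_ball incl_left_act incl_right_act left_act_closed right_act_closed
    incl_closed incl_simps E.A.l_distr E.A.r_distr E.smult_mult_left E.smult_mult_right E.A.m_assoc
    proj_simps(1,2,4)[symmetric] proj_simps(3)[symmetric, OF E.A.one_closed E.A.one_closed]
  show ?thesis
  proof (unfold_locales, goal_cases)
    case (1 c) then show ?case
      by (elim base_elem) (auto simp: s intro!: ker_eqI)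
  next
    case (2 b) then show ?case by (auto simp: s intro!: ker_eqI)
  next
    case (3 c) then show ?case by (elim base_elem) (auto simp: s intro!: ker_eqI)
  next
    case (4 b) then show ?case by (auto simp: s intro!: ker_eqI)
  next
    case (5 b) then show ?case by (auto simp: s intro!: ker_eqI)
  next
    case (6 b) then show ?case by (auto simp: s intro!: ker_eqI)
  next
    case (7 c c' b) then show ?case by (elim base_elem) (auto simp: s intro!: ker_eqI)
  next
    case (8 c c' b) then show ?case by (elim base_elem) (auto simp: s intro!: ker_eqI)
  next
    case (9 c c' b) then show ?case by (elim base_elem) (auto simp: s intro!: ker_eqI)
  qed
qed

end

definition extension_morphism ::
  "('k, 'n) ring_scheme \<Rightarrow> ('k, 'b, 'e, 'c) extension \<Rightarrow> ('k, 'a, 'f, 'd) extension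
    \<Rightarrow> ('b \<Rightarrow> 'a) \<Rightarrow> ('e \<Rightarrow> 'f) \<Rightarrow> ('c \<Rightarrow> 'd) \<Rightarrow> bool"
  where "extension_morphism K \<E> \<E>' \<beta> \<epsilon> \<gamma> \<longleftrightarrow>
    \<beta> \<in> linear_maps K (ext_ker \<E>) (ext_ker \<E>') \<and>
    \<epsilon> \<in> algebra_homs K (ext_alg \<E>) (ext_alg \<E>') \<and>
    \<gamma> \<in> algebra_homs K (ext_base \<E>) (ext_base \<E>') \<and>
    (\<forall>b \<in> carrier (ext_ker \<E>). \<epsilon> (ext_incl \<E> b) = ext_incl \<E>' (\<beta> b)) \<and>
    (\<forall>e \<in> carrier (ext_alg \<E>). ext_proj \<E>' (\<epsilon> e) = \<gamma> (ext_proj \<E> e))"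

definition equivalent_extensions ::
  "('k, 'n) ring_scheme \<Rightarrow> ('k, 'b, 'e, 'c) extension \<Rightarrow> ('k, 'b, 'f, 'c) extension \<Rightarrow> bool"
  where "equivalent_extensions K \<E> Y \<longleftrightarrow>
    ext_ker \<E> = ext_ker Y \<and> ext_base \<E> = ext_base Y \<and>
    (\<exists>\<epsilon>. extension_morphism K \<E> Y id \<epsilon> id \<and>
      bij_betw \<epsilon> (carrier (ext_alg \<E>)) (carrier (ext_alg Y)))"

text \<open>
  A morphism with prescribed outer components is given by its middle component, which is
  normalised outside of the carrier.
\<close>

definition OPEXT ::
  "('k, 'n) ring_scheme \<Rightarrow> ('c \<Rightarrow> 'd) \<Rightarrow> ('b \<Rightarrow> 'a)
    \<Rightarrow> ('k, 'b, 'e, 'c) extension \<Rightarrow> ('k, 'a, 'f, 'd) extension \<Rightarrow> ('e \<Rightarrow> 'f) set"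
  where "OPEXT K \<phi>\<^sub>0 \<phi>\<^sub>1 \<E> \<E>' =
    {\<epsilon> \<in> extensional (carrier (ext_alg \<E>)). extension_morphism K \<E> \<E>' \<phi>\<^sub>1 \<epsilon> \<phi>\<^sub>0}"


section \<open>Pullback and push forward\<close>

definition pullback_extension ::
  "('k, 'c) module \<Rightarrow> ('c \<Rightarrow> 'd) \<Rightarrow> ('k, 'a, 'f, 'd) extension \<Rightarrow> ('k, 'a, 'f \<times> 'c, 'c) extension"
  where "pullback_extension C \<phi> \<E> =
    \<lparr>ext_ker = ext_ker \<E>,
     ext_alg =
      \<lparr>carrier = {(e, c). e \<in> carrier (ext_alg \<E>) \<and> c \<in> carrier C \<and> ext_proj \<E> e = \<phi> c},
       mult = (\<lambda>(e, c) (e', c'). (e \<otimes>\<^bsub>ext_alg \<E>\<^esub> e', c \<otimes>\<^bsub>C\<^esub> c')),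
       one = (\<one>\<^bsub>ext_alg \<E>\<^esub>, \<one>\<^bsub>C\<^esub>),
       zero = (\<zero>\<^bsub>ext_alg \<E>\<^esub>, \<zero>\<^bsub>C\<^esub>),
       add = (\<lambda>(e, c) (e', c'). (e \<oplus>\<^bsub>ext_alg \<E>\<^esub> e', c \<oplus>\<^bsub>C\<^esub> c')),
       smult = (\<lambda>a (e, c). (a \<odot>\<^bsub>ext_alg \<E>\<^esub> e, a \<odot>\<^bsub>C\<^esub> c))\<rparr>,
     ext_base = C,
     ext_incl = (\<lambda>b. (ext_incl \<E> b, \<zero>\<^bsub>C\<^esub>)),
     ext_proj = snd\<rparr>"

text \<open>\<open>M\<close> is a bimodule over \<open>A\<close>, regarded as an algebra with zero multiplication.\<close>

definition semidirect_sum ::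
  "('k, 'b) module \<Rightarrow> ('k, 'e) module \<Rightarrow> ('e \<Rightarrow> 'b \<Rightarrow> 'b) \<Rightarrow> ('b \<Rightarrow> 'e \<Rightarrow> 'b) \<Rightarrow> ('k, 'b \<times> 'e) module"
  where "semidirect_sum M A l r =
    \<lparr>carrier = carrier M \<times> carrier A,
     mult = (\<lambda>(b, e) (b', e'). (l e b' \<oplus>\<^bsub>M\<^esub> r b e', e \<otimes>\<^bsub>A\<^esub> e')),
     one = (\<zero>\<^bsub>M\<^esub>, \<one>\<^bsub>A\<^esub>),
     zero = (\<zero>\<^bsub>M\<^esub>, \<zero>\<^bsub>A\<^esub>),
     add = (\<lambda>(b, e) (b', e'). (b \<oplus>\<^bsub>M\<^esub> b', e \<oplus>\<^bsub>A\<^esub> e')),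
     smult = (\<lambda>a (b, e). (a \<odot>\<^bsub>M\<^esub> b, a \<odot>\<^bsub>A\<^esub> e))\<rparr>"

definition quotient_algebra :: "('k, 'e, 'm) module_scheme \<Rightarrow> 'e set \<Rightarrow> ('k, 'e set) module"
  where "quotient_algebra A I =
    \<lparr>carrier = carrier (A Quot I), mult = mult (A Quot I), one = one (A Quot I),
     zero = zero (A Quot I), add = add (A Quot I),
     smult = (\<lambda>a Y. \<Union>x \<in> Y. I +>\<^bsub>A\<^esub> (a \<odot>\<^bsub>A\<^esub> x))\<rparr>"

text \<open>
  Push forward along a map \<open>\<phi>\<close> of bimodules over the base from the kernel to the bimodule \<open>M\<close>,
  with actions \<open>l\<close> and \<open>r\<close>. The projection takes the common image of the representatives of a
  coset.
\<close>

definition pushforward_extension ::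
  "('k, 'a) module \<Rightarrow> ('c \<Rightarrow> 'a \<Rightarrow> 'a) \<Rightarrow> ('a \<Rightarrow> 'c \<Rightarrow> 'a) \<Rightarrow> ('b \<Rightarrow> 'a)
    \<Rightarrow> ('k, 'b, 'e, 'c) extension \<Rightarrow> ('k, 'a, ('a \<times> 'e) set, 'c) extension"
  where "pushforward_extension M l r \<phi> \<E> =
    (let S = semidirect_sum M (ext_alg \<E>)
               (\<lambda>e m. l (ext_proj \<E> e) m) (\<lambda>m e. r m (ext_proj \<E> e));
         N = {(\<ominus>\<^bsub>M\<^esub> \<phi> b, ext_incl \<E> b) | b. b \<in> carrier (ext_ker \<E>)}
     in \<lparr>ext_ker = M,
         ext_alg = quotient_algebra S N,
         ext_base = ext_base \<E>,
         ext_incl = (\<lambda>m. N +>\<^bsub>S\<^esub> (m, \<zero>\<^bsub>ext_alg \<E>\<^esub>)),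
         ext_proj = (\<lambda>Y. the_elem ((\<lambda>(m, e). ext_proj \<E> e) ` Y))\<rparr>)"


subsection \<open>Both constructions give singular extensions\<close>

lemma unital_algebraI:
  assumes "module K A" "ring A"
    and "\<And>a x y. \<lbrakk>a \<in> carrier K; x \<in> carrier A; y \<in> carrier A\<rbrakk>
        \<Longrightarrow> (a \<odot>\<^bsub>A\<^esub> x) \<otimes>\<^bsub>A\<^esub> y = a \<odot>\<^bsub>A\<^esub> (x \<otimes>\<^bsub>A\<^esub> y)"
    and "\<And>a x y. \<lbrakk>a \<in> carrier K; x \<in> carrier A; y \<in> carrier A\<rbrakk>
        \<Longrightarrow> x \<otimes>\<^bsub>A\<^esub> (a \<odot>\<^bsub>A\<^esub> y) = a \<odot>\<^bsub>A\<^esub> (x \<otimes>\<^bsub>A\<^esub> y)"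
  shows "unital_algebra K A"
  using assms by (intro unital_algebra.intro unital_algebra_axioms.intro)

lemma (in bimodule) semidirect_sum_algebra: "unital_algebra K (semidirect_sum B C l r)"
proof -
  let ?S = "semidirect_sum B C l r"
  have cl: "\<And>c b. \<lbrakk>c \<in> carrier C; b \<in> carrier B\<rbrakk> \<Longrightarrow> l c b \<in> carrier B"
    "\<And>c b. \<lbrakk>c \<in> carrier C; b \<in> carrier B\<rbrakk> \<Longrightarrow> r b c \<in> carrier B"
    using l_linear r_linear by (auto simp: linear_maps_iff)
  have ad: "\<And>c b b'. \<lbrakk>c \<in> carrier C; b \<in> carrier B; b' \<in> carrier B\<rbrakk>
      \<Longrightarrow> l c (b \<oplus>\<^bsub>B\<^esub> b') = l c b \<oplus>\<^bsub>B\<^esub> l c b'"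
    "\<And>c b b'. \<lbrakk>c \<in> carrier C; b \<in> carrier B; b' \<in> carrier B\<rbrakk>
      \<Longrightarrow> r (b \<oplus>\<^bsub>B\<^esub> b') c = r b c \<oplus>\<^bsub>B\<^esub> r b' c"
    "\<And>c c' b. \<lbrakk>c \<in> carrier C; c' \<in> carrier C; b \<in> carrier B\<rbrakk>
      \<Longrightarrow> l (c \<oplus>\<^bsub>C\<^esub> c') b = l c b \<oplus>\<^bsub>B\<^esub> l c' b"
    "\<And>c c' b. \<lbrakk>c \<in> carrier C; c' \<in> carrier C; b \<in> carrier B\<rbrakk>
      \<Longrightarrow> r b (c \<oplus>\<^bsub>C\<^esub> c') = r b c \<oplus>\<^bsub>B\<^esub> r b c'"
    "\<And>a c b. \<lbrakk>a \<in> carrier K; c \<in> carrier C; b \<in> carrier B\<rbrakk>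
      \<Longrightarrow> l c (a \<odot>\<^bsub>B\<^esub> b) = a \<odot>\<^bsub>B\<^esub> l c b"
    "\<And>a c b. \<lbrakk>a \<in> carrier K; c \<in> carrier C; b \<in> carrier B\<rbrakk>
      \<Longrightarrow> r (a \<odot>\<^bsub>B\<^esub> b) c = a \<odot>\<^bsub>B\<^esub> r b c"
    "\<And>a c b. \<lbrakk>a \<in> carrier K; c \<in> carrier C; b \<in> carrier B\<rbrakk>
      \<Longrightarrow> l (a \<odot>\<^bsub>C\<^esub> c) b = a \<odot>\<^bsub>B\<^esub> l c b"
    "\<And>a c b. \<lbrakk>a \<in> carrier K; c \<in> carrier C; b \<in> carrier B\<rbrakk>
      \<Longrightarrow> r b (a \<odot>\<^bsub>C\<^esub> c) = a \<odot>\<^bsub>B\<^esub> r b c"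
    using l_linear r_linear l_linear' r_linear' by (simp_all add: linear_maps_iff)
  have zr: "r \<zero>\<^bsub>B\<^esub> c = \<zero>\<^bsub>B\<^esub>" "l c \<zero>\<^bsub>B\<^esub> = \<zero>\<^bsub>B\<^esub>" if c: "c \<in> carrier C" for c
  proof -
    have "r (\<zero>\<^bsub>K\<^esub> \<odot>\<^bsub>B\<^esub> \<zero>\<^bsub>B\<^esub>) c = \<zero>\<^bsub>K\<^esub> \<odot>\<^bsub>B\<^esub> r \<zero>\<^bsub>B\<^esub> c" "l c (\<zero>\<^bsub>K\<^esub> \<odot>\<^bsub>B\<^esub> \<zero>\<^bsub>B\<^esub>) = \<zero>\<^bsub>K\<^esub> \<odot>\<^bsub>B\<^esub> l c \<zero>\<^bsub>B\<^esub>"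
      by (rule ad; simp add: c)+
    then show "r \<zero>\<^bsub>B\<^esub> c = \<zero>\<^bsub>B\<^esub>" "l c \<zero>\<^bsub>B\<^esub> = \<zero>\<^bsub>B\<^esub>" using c by (simp_all add: cl)
  qed
  have ab: "abelian_group ?S"
  proof (rule abelian_groupI)
    fix x assume "x \<in> carrier ?S"
    then show "\<exists>y\<in>carrier ?S. y \<oplus>\<^bsub>?S\<^esub> x = \<zero>\<^bsub>?S\<^esub>"
      by (intro bexI[of _ "(\<ominus>\<^bsub>B\<^esub> fst x, \<ominus>\<^bsub>C\<^esub> snd x)"])
        (auto simp: semidirect_sum_def B.M.l_neg C.M.l_neg)
  qed (auto simp: semidirect_sum_def B.M.a_ac C.M.a_ac)
  show ?thesis
  proof (rule unital_algebraI)
    show "module K ?S"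
      by (rule moduleI[OF _ ab]) (auto simp: C.is_cring semidirect_sum_def B.smult_l_distr B.smult_r_distr
          C.smult_l_distr C.smult_r_distr B.smult_assoc1 C.smult_assoc1)
    show "ring ?S"
    proof (rule ringI[OF ab])
      show "Group.monoid ?S"
        by (rule monoidI) (auto simp: semidirect_sum_def cl ad zr l_one r_one l_mult r_mult l_r
            C.A.m_assoc B.M.a_assoc)
    qed (auto simp: semidirect_sum_def cl ad C.A.l_distr C.A.r_distr B.M.a_ac)
  qed (auto simp: semidirect_sum_def cl ad C.smult_mult_left C.smult_mult_right B.smult_r_distr)
qed

context unital_algebra
begin

context
  fixes I assumes I: "ideal I A"
begin

interpretation I: ideal I A by (rule I)

lemma smult_ideal: "\<lbrakk>a \<in> carrier K; x \<in> I\<rbrakk> \<Longrightarrow> a \<odot>\<^bsub>A\<^esub> x \<in> I"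
  using smult_mult_left[of a "\<one>\<^bsub>A\<^esub>" x] I.I_l_closed[of x "a \<odot>\<^bsub>A\<^esub> \<one>\<^bsub>A\<^esub>"] I.a_Hcarr
  by simp

lemma quotient_smult:
  assumes "a \<in> carrier K" "x \<in> carrier A"
  shows "a \<odot>\<^bsub>quotient_algebra A I\<^esub> (I +>\<^bsub>A\<^esub> x) = I +>\<^bsub>A\<^esub> (a \<odot>\<^bsub>A\<^esub> x)"
proof -
  have "I +>\<^bsub>A\<^esub> (a \<odot>\<^bsub>A\<^esub> y) = I +>\<^bsub>A\<^esub> (a \<odot>\<^bsub>A\<^esub> x)" if y: "y \<in> I +>\<^bsub>A\<^esub> x" for y
  proof -
    obtain i where i: "i \<in> I" "y = i \<oplus>\<^bsub>A\<^esub> x" using y by (auto simp: a_r_coset_def')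
    then have "a \<odot>\<^bsub>A\<^esub> y = a \<odot>\<^bsub>A\<^esub> i \<oplus>\<^bsub>A\<^esub> a \<odot>\<^bsub>A\<^esub> x"
      using assms by (simp add: smult_r_distr I.a_Hcarr)
    then have "a \<odot>\<^bsub>A\<^esub> y \<in> I +>\<^bsub>A\<^esub> (a \<odot>\<^bsub>A\<^esub> x)"
      using smult_ideal[OF assms(1) i(1)] by (auto simp: a_r_coset_def')
    then show ?thesis
      using a_repr_independence[OF _ smult_closed[OF assms] I.a_subgroup] by metis
  qed
  moreover have "x \<in> I +>\<^bsub>A\<^esub> x" using assms I.a_rcos_self by blast
  ultimately have "(\<Union>y \<in> I +>\<^bsub>A\<^esub> x. I +>\<^bsub>A\<^esub> (a \<odot>\<^bsub>A\<^esub> y)) = I +>\<^bsub>A\<^esub> (a \<odot>\<^bsub>A\<^esub> x)"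
    by (intro SUP_eq_const) blast+
  then show ?thesis by (simp add: quotient_algebra_def)
qed

lemma quotient_simps:
  "carrier (quotient_algebra A I) = (\<lambda>x. I +>\<^bsub>A\<^esub> x) ` carrier A"
  "\<zero>\<^bsub>quotient_algebra A I\<^esub> = I +>\<^bsub>A\<^esub> \<zero>\<^bsub>A\<^esub>"
  "\<one>\<^bsub>quotient_algebra A I\<^esub> = I +>\<^bsub>A\<^esub> \<one>\<^bsub>A\<^esub>"
  "\<lbrakk>x \<in> carrier A; y \<in> carrier A\<rbrakk> \<Longrightarrow>
    (I +>\<^bsub>A\<^esub> x) \<oplus>\<^bsub>quotient_algebra A I\<^esub> (I +>\<^bsub>A\<^esub> y) = I +>\<^bsub>A\<^esub> (x \<oplus>\<^bsub>A\<^esub> y)"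
  "\<lbrakk>x \<in> carrier A; y \<in> carrier A\<rbrakk> \<Longrightarrow>
    (I +>\<^bsub>A\<^esub> x) \<otimes>\<^bsub>quotient_algebra A I\<^esub> (I +>\<^bsub>A\<^esub> y) = I +>\<^bsub>A\<^esub> (x \<otimes>\<^bsub>A\<^esub> y)"
  using I.a_rcos_sum I.rcoset_mult_add a_coset_add_zero[OF I.a_subset]
  by (auto simp: quotient_algebra_def FactRing_def A_RCOSETS_def' a_r_coset_def')

lemma quotient_algebra: "unital_algebra K (quotient_algebra A I)"
proof -
  let ?Q = "quotient_algebra A I"
  note s = quotient_simps quotient_smult
  have ab: "abelian_group ?Q"
  proof (rule abelian_groupI)
    fix x assume "x \<in> carrier ?Q"
    then obtain y where "y \<in> carrier A" "x = I +>\<^bsub>A\<^esub> y" by (auto simp: s)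
    then show "\<exists>y\<in>carrier ?Q. y \<oplus>\<^bsub>?Q\<^esub> x = \<zero>\<^bsub>?Q\<^esub>"
      by (intro bexI[of _ "I +>\<^bsub>A\<^esub> (\<ominus>\<^bsub>A\<^esub> y)"]) (auto simp: s M.l_neg)
  qed (auto simp: s M.a_ac)
  show ?thesis
  proof (rule unital_algebraI)
    show "module K ?Q"
      by (rule moduleI) (auto simp: ab is_cring s smult_l_distr smult_r_distr smult_assoc1)
    show "ring ?Q"
    proof (rule ringI[OF ab])
      show "Group.monoid ?Q" by (rule monoidI) (auto simp: s A.m_assoc)
    qed (auto simp: s A.l_distr A.r_distr)
  qed (auto simp: s smult_mult_left smult_mult_right)
qed

end

end


context singular_extension
begin

interpretation B: module K "ext_ker \<E>" by (rule ker_module)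
interpretation E: unital_algebra K "ext_alg \<E>" by (rule alg_algebra)
interpretation C: unital_algebra K "ext_base \<E>" by (rule base_algebra)

lemma proj_zero: "ext_proj \<E> \<zero>\<^bsub>ext_alg \<E>\<^esub> = \<zero>\<^bsub>ext_base \<E>\<^esub>"
  and incl_zero: "ext_incl \<E> \<zero>\<^bsub>ext_ker \<E>\<^esub> = \<zero>\<^bsub>ext_alg \<E>\<^esub>"
proof -
  show "ext_proj \<E> \<zero>\<^bsub>ext_alg \<E>\<^esub> = \<zero>\<^bsub>ext_base \<E>\<^esub>"
    using proj_simps(4)[of "\<zero>\<^bsub>ext_alg \<E>\<^esub>" "\<zero>\<^bsub>ext_alg \<E>\<^esub>" "\<zero>\<^bsub>K\<^esub>"] by (simp add: proj_closed)
  show "ext_incl \<E> \<zero>\<^bsub>ext_ker \<E>\<^esub> = \<zero>\<^bsub>ext_alg \<E>\<^esub>"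
    using incl_simps(2)[of "\<zero>\<^bsub>ext_ker \<E>\<^esub>" "\<zero>\<^bsub>ext_ker \<E>\<^esub>" "\<zero>\<^bsub>K\<^esub>"] by (simp add: incl_closed)
qed

lemma proj_incl: "b \<in> carrier (ext_ker \<E>) \<Longrightarrow> ext_proj \<E> (ext_incl \<E> b) = \<zero>\<^bsub>ext_base \<E>\<^esub>"
  using incl_mem_ker by (auto simp: a_kernel_def')

lemma proj_eq_zero:
  assumes "e \<in> carrier (ext_alg \<E>)" "ext_proj \<E> e = \<zero>\<^bsub>ext_base \<E>\<^esub>"
  obtains b where "b \<in> carrier (ext_ker \<E>)" "e = ext_incl \<E> b"
  using assms exact by (auto simp: a_kernel_def' set_eq_iff image_iff)

lemma pullback_singular:
  assumes D: "unital_algebra K D" and \<phi>: "\<phi> \<in> algebra_homs K D (ext_base \<E>)"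
  shows "singular_extension K (pullback_extension D \<phi> \<E>)"
proof -
  interpret D: unital_algebra K D by (rule D)
  let ?P = "ext_alg (pullback_extension D \<phi> \<E>)"
  have h: "\<And>x. x \<in> carrier D \<Longrightarrow> \<phi> x \<in> carrier (ext_base \<E>)"
    "\<And>x y. \<lbrakk>x \<in> carrier D; y \<in> carrier D\<rbrakk> \<Longrightarrow> \<phi> (x \<oplus>\<^bsub>D\<^esub> y) = \<phi> x \<oplus>\<^bsub>ext_base \<E>\<^esub> \<phi> y"
    "\<And>x y. \<lbrakk>x \<in> carrier D; y \<in> carrier D\<rbrakk> \<Longrightarrow> \<phi> (x \<otimes>\<^bsub>D\<^esub> y) = \<phi> x \<otimes>\<^bsub>ext_base \<E>\<^esub> \<phi> y"
    "\<And>a x. \<lbrakk>a \<in> carrier K; x \<in> carrier D\<rbrakk> \<Longrightarrow> \<phi> (a \<odot>\<^bsub>D\<^esub> x) = a \<odot>\<^bsub>ext_base \<E>\<^esub> \<phi> x"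
    "\<phi> \<one>\<^bsub>D\<^esub> = \<one>\<^bsub>ext_base \<E>\<^esub>"
    using \<phi> by (auto simp: algebra_homs_iff linear_maps_iff)
  have \<phi>0: "\<phi> \<zero>\<^bsub>D\<^esub> = \<zero>\<^bsub>ext_base \<E>\<^esub>"
    using h(4)[of "\<zero>\<^bsub>K\<^esub>" "\<zero>\<^bsub>D\<^esub>"] by (simp add: h(1))
  note p1 = proj_simps(3)[OF E.M.zero_closed E.M.zero_closed]
  note s = pullback_extension_def h \<phi>0 p1 proj_zero proj_simps(1,2,4)
  have ab: "abelian_group ?P"
  proof (rule abelian_groupI)
    fix x assume "x \<in> carrier ?P"
    then obtain e d where ed: "x = (e, d)" "e \<in> carrier (ext_alg \<E>)" "d \<in> carrier D" "ext_proj \<E> e = \<phi> d"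
      by (auto simp: pullback_extension_def)
    let ?m = "\<ominus>\<^bsub>K\<^esub> \<one>\<^bsub>K\<^esub>"
    have "(?m \<odot>\<^bsub>ext_alg \<E>\<^esub> e, ?m \<odot>\<^bsub>D\<^esub> d) \<in> carrier ?P"
      using ed by (simp add: s)
    moreover have "(?m \<odot>\<^bsub>ext_alg \<E>\<^esub> e, ?m \<odot>\<^bsub>D\<^esub> d) \<oplus>\<^bsub>?P\<^esub> x = \<zero>\<^bsub>?P\<^esub>"
      using ed by (simp add: pullback_extension_def E.smult_l_minus D.smult_l_minus E.M.l_neg D.M.l_neg)
    ultimately show "\<exists>y\<in>carrier ?P. y \<oplus>\<^bsub>?P\<^esub> x = \<zero>\<^bsub>?P\<^esub>" by blast
  qed (auto simp: s E.M.a_ac D.M.a_ac)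
  have alg: "unital_algebra K ?P"
  proof (rule unital_algebraI)
    show "module K ?P"
      by (rule moduleI[OF _ ab]) (auto simp: s is_cring E.smult_l_distr E.smult_r_distr
          D.smult_l_distr D.smult_r_distr E.smult_assoc1 D.smult_assoc1)
    show "ring ?P"
    proof (rule ringI[OF ab])
      show "Group.monoid ?P"
        by (rule monoidI) (auto simp: s E.A.m_assoc D.A.m_assoc)
    qed (auto simp: s E.A.l_distr E.A.r_distr D.A.l_distr D.A.r_distr)
  qed (auto simp: s E.smult_mult_left E.smult_mult_right D.smult_mult_left D.smult_mult_right)
  show ?thesis
  proof (rule singular_extension.intro[OF field_axioms], rule singular_extension_axioms.intro)
    show "unital_algebra K ?P" by (rule alg)
    show "ext_proj (pullback_extension D \<phi> \<E>) ` carrier ?P = carrier (ext_base (pullback_extension D \<phi> \<E>))"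
    proof (intro equalityI subsetI)
      fix d assume "d \<in> carrier (ext_base (pullback_extension D \<phi> \<E>))"
      then have d: "d \<in> carrier D" by (simp add: pullback_extension_def)
      then obtain e where "e \<in> carrier (ext_alg \<E>)" "\<phi> d = ext_proj \<E> e"
        using base_elem h(1) by blast
      then have "(e, d) \<in> carrier ?P" using d by (simp add: pullback_extension_def)
      then show "d \<in> ext_proj (pullback_extension D \<phi> \<E>) ` carrier ?P"
        by (rule rev_image_eqI) (simp add: pullback_extension_def)
    qed (auto simp: pullback_extension_def)
    show "ext_incl (pullback_extension D \<phi> \<E>) ` carrier (ext_ker (pullback_extension D \<phi> \<E>)) =
      a_kernel ?P (ext_base (pullback_extension D \<phi> \<E>)) (ext_proj (pullback_extension D \<phi> \<E>))"
      by (auto simp: pullback_extension_def a_kernel_def' incl_closed proj_incl \<phi>0 image_iff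
          elim!: proj_eq_zero)
  qed (auto simp: s ker_module D algebra_homs_iff linear_maps_iff incl_closed incl_simps proj_incl
      square_zero inj_on_def incl_eq_iff)
qed

lemma pushforward_singular:
  assumes M: "bimodule K (ext_base \<E>) M l r" and \<phi>: "\<phi> \<in> linear_maps K (ext_ker \<E>) M"
    and \<phi>_l: "\<And>c b. \<lbrakk>c \<in> carrier (ext_base \<E>); b \<in> carrier (ext_ker \<E>)\<rbrakk>
      \<Longrightarrow> \<phi> (left_act \<E> c b) = l c (\<phi> b)"
    and \<phi>_r: "\<And>c b. \<lbrakk>c \<in> carrier (ext_base \<E>); b \<in> carrier (ext_ker \<E>)\<rbrakk>
      \<Longrightarrow> \<phi> (right_act \<E> b c) = r (\<phi> b) c"
  shows "singular_extension K (pushforward_extension M l r \<phi> \<E>)"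
proof -
  interpret M: bimodule K "ext_base \<E>" M l r by (rule M)
  define l' where "l' = (\<lambda>e m. l (ext_proj \<E> e) m)"
  define r' where "r' = (\<lambda>m e. r m (ext_proj \<E> e))"
  define S where "S = semidirect_sum M (ext_alg \<E>) l' r'"
  define N where "N = {(\<ominus>\<^bsub>M\<^esub> \<phi> b, ext_incl \<E> b) | b. b \<in> carrier (ext_ker \<E>)}"
  note p1 = proj_simps(3)[OF E.M.zero_closed E.M.zero_closed]
  interpret M': bimodule K "ext_alg \<E>" M l' r'
    using M.l_linear M.r_linear M.l_linear' M.r_linear'
    by unfold_locales
      (auto simp: l'_def r'_def linear_maps_iff proj_closed proj_simps(1,2,4) p1
        M.l_one M.r_one M.l_mult M.r_mult M.l_r)
  interpret S: unital_algebra K S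
    unfolding S_def by (rule M'.semidirect_sum_algebra)
  have S_simps: "carrier S = carrier M \<times> carrier (ext_alg \<E>)" "\<zero>\<^bsub>S\<^esub> = (\<zero>\<^bsub>M\<^esub>, \<zero>\<^bsub>ext_alg \<E>\<^esub>)"
    "\<one>\<^bsub>S\<^esub> = (\<zero>\<^bsub>M\<^esub>, \<one>\<^bsub>ext_alg \<E>\<^esub>)"
    "\<And>m e n d. (m, e) \<oplus>\<^bsub>S\<^esub> (n, d) = (m \<oplus>\<^bsub>M\<^esub> n, e \<oplus>\<^bsub>ext_alg \<E>\<^esub> d)"
    "\<And>m e n d. (m, e) \<otimes>\<^bsub>S\<^esub> (n, d) = (l' e n \<oplus>\<^bsub>M\<^esub> r' m d, e \<otimes>\<^bsub>ext_alg \<E>\<^esub> d)"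
    "\<And>a m e. a \<odot>\<^bsub>S\<^esub> (m, e) = (a \<odot>\<^bsub>M\<^esub> m, a \<odot>\<^bsub>ext_alg \<E>\<^esub> e)"
    by (simp_all add: S_def semidirect_sum_def)
  have l_cl: "\<And>c m. \<lbrakk>c \<in> carrier (ext_base \<E>); m \<in> carrier M\<rbrakk> \<Longrightarrow> l c m \<in> carrier M"
    and r_cl: "\<And>c m. \<lbrakk>c \<in> carrier (ext_base \<E>); m \<in> carrier M\<rbrakk> \<Longrightarrow> r m c \<in> carrier M"
    and l_0: "\<And>m. m \<in> carrier M \<Longrightarrow> l \<zero>\<^bsub>ext_base \<E>\<^esub> m = \<zero>\<^bsub>M\<^esub>"
    and r_0: "\<And>m. m \<in> carrier M \<Longrightarrow> r m \<zero>\<^bsub>ext_base \<E>\<^esub> = \<zero>\<^bsub>M\<^esub>"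
    and l_00: "\<And>c. c \<in> carrier (ext_base \<E>) \<Longrightarrow> l c \<zero>\<^bsub>M\<^esub> = \<zero>\<^bsub>M\<^esub>"
    and r_00: "\<And>c. c \<in> carrier (ext_base \<E>) \<Longrightarrow> r \<zero>\<^bsub>M\<^esub> c = \<zero>\<^bsub>M\<^esub>"
    and l_m: "\<And>c m. \<lbrakk>c \<in> carrier (ext_base \<E>); m \<in> carrier M\<rbrakk> \<Longrightarrow> l c (\<ominus>\<^bsub>M\<^esub> m) = \<ominus>\<^bsub>M\<^esub> l c m"
    and r_m: "\<And>c m. \<lbrakk>c \<in> carrier (ext_base \<E>); m \<in> carrier M\<rbrakk> \<Longrightarrow> r (\<ominus>\<^bsub>M\<^esub> m) c = \<ominus>\<^bsub>M\<^esub> r m c"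
    using M.l_linear M.r_linear M.l_linear' M.r_linear'
  proof -
    have lin0: "h \<zero>\<^bsub>U\<^esub> = \<zero>\<^bsub>V\<^esub>"
      if "h \<in> linear_maps K U V" "module K U" "module K V"
      for h and U :: "('k, 'u) module" and V :: "('k, 'v) module"
    proof -
      interpret U: module K U by (rule that)
      interpret V: module K V by (rule that)
      have "h (\<zero>\<^bsub>K\<^esub> \<odot>\<^bsub>U\<^esub> \<zero>\<^bsub>U\<^esub>) = \<zero>\<^bsub>K\<^esub> \<odot>\<^bsub>V\<^esub> h \<zero>\<^bsub>U\<^esub>" "h \<zero>\<^bsub>U\<^esub> \<in> carrier V"
        using that(1) U.M.zero_closed zero_closed unfolding linear_maps_iff by blast+
      then show ?thesis by simp
    qed
    show "l c m \<in> carrier M" "r m c \<in> carrier M" if "c \<in> carrier (ext_base \<E>)" "m \<in> carrier M" for c m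
      using that M.l_linear M.r_linear by (auto simp: linear_maps_iff)
    then have cl: "\<And>c m. \<lbrakk>c \<in> carrier (ext_base \<E>); m \<in> carrier M\<rbrakk> \<Longrightarrow> l c m \<in> carrier M"
      "\<And>c m. \<lbrakk>c \<in> carrier (ext_base \<E>); m \<in> carrier M\<rbrakk> \<Longrightarrow> r m c \<in> carrier M" by auto
    show z: "l \<zero>\<^bsub>ext_base \<E>\<^esub> m = \<zero>\<^bsub>M\<^esub>" "r m \<zero>\<^bsub>ext_base \<E>\<^esub> = \<zero>\<^bsub>M\<^esub>" if "m \<in> carrier M" for m
      using lin0[OF M.l_linear'[OF that] C.module_axioms M.B.module_axioms]
        lin0[OF M.r_linear'[OF that] C.module_axioms M.B.module_axioms] by auto
    show z0: "l c \<zero>\<^bsub>M\<^esub> = \<zero>\<^bsub>M\<^esub>" "r \<zero>\<^bsub>M\<^esub> c = \<zero>\<^bsub>M\<^esub>" if "c \<in> carrier (ext_base \<E>)" for c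
      using lin0[OF M.l_linear[OF that] M.B.module_axioms M.B.module_axioms]
        lin0[OF M.r_linear[OF that] M.B.module_axioms M.B.module_axioms] by auto
    show "l c (\<ominus>\<^bsub>M\<^esub> m) = \<ominus>\<^bsub>M\<^esub> l c m" "r (\<ominus>\<^bsub>M\<^esub> m) c = \<ominus>\<^bsub>M\<^esub> r m c"
      if c: "c \<in> carrier (ext_base \<E>)" "m \<in> carrier M" for c m
    proof -
      have "l c (\<ominus>\<^bsub>M\<^esub> m) \<oplus>\<^bsub>M\<^esub> l c m = l c (\<ominus>\<^bsub>M\<^esub> m \<oplus>\<^bsub>M\<^esub> m)"
        "r (\<ominus>\<^bsub>M\<^esub> m) c \<oplus>\<^bsub>M\<^esub> r m c = r (\<ominus>\<^bsub>M\<^esub> m \<oplus>\<^bsub>M\<^esub> m) c"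
        using M.l_linear[OF c(1)] M.r_linear[OF c(1)] c(2) by (simp_all add: linear_maps_iff)
      then have "l c (\<ominus>\<^bsub>M\<^esub> m) \<oplus>\<^bsub>M\<^esub> l c m = \<zero>\<^bsub>M\<^esub>" "r (\<ominus>\<^bsub>M\<^esub> m) c \<oplus>\<^bsub>M\<^esub> r m c = \<zero>\<^bsub>M\<^esub>"
        using c by (simp_all add: M.B.M.l_neg z0)
      then show "l c (\<ominus>\<^bsub>M\<^esub> m) = \<ominus>\<^bsub>M\<^esub> l c m" "r (\<ominus>\<^bsub>M\<^esub> m) c = \<ominus>\<^bsub>M\<^esub> r m c"
        using c cl M.B.M.minus_equality by (metis M.B.M.a_inv_closed)+
    qed
  qed
  have \<phi>s: "\<And>b. b \<in> carrier (ext_ker \<E>) \<Longrightarrow> \<phi> b \<in> carrier M"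
    "\<And>b b'. \<lbrakk>b \<in> carrier (ext_ker \<E>); b' \<in> carrier (ext_ker \<E>)\<rbrakk>
      \<Longrightarrow> \<phi> (b \<oplus>\<^bsub>ext_ker \<E>\<^esub> b') = \<phi> b \<oplus>\<^bsub>M\<^esub> \<phi> b'"
    "\<And>a b. \<lbrakk>a \<in> carrier K; b \<in> carrier (ext_ker \<E>)\<rbrakk> \<Longrightarrow> \<phi> (a \<odot>\<^bsub>ext_ker \<E>\<^esub> b) = a \<odot>\<^bsub>M\<^esub> \<phi> b"
    using \<phi> by (auto simp: linear_maps_iff)
  have \<phi>0: "\<phi> \<zero>\<^bsub>ext_ker \<E>\<^esub> = \<zero>\<^bsub>M\<^esub>"
    using \<phi>s(3)[of "\<zero>\<^bsub>K\<^esub>" "\<zero>\<^bsub>ext_ker \<E>\<^esub>"] by (simp add: \<phi>s(1))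
  have N_mem: "(\<ominus>\<^bsub>M\<^esub> \<phi> b, ext_incl \<E> b) \<in> N" if "b \<in> carrier (ext_ker \<E>)" for b
    using that unfolding N_def by blast
  have N_elim: "\<exists>b \<in> carrier (ext_ker \<E>). x = (\<ominus>\<^bsub>M\<^esub> \<phi> b, ext_incl \<E> b)" if "x \<in> N" for x
    using that unfolding N_def by blast
  have N_sub: "N \<subseteq> carrier S"
    by (auto simp: N_def S_simps \<phi>s incl_closed)
  have N_add: "x \<oplus>\<^bsub>S\<^esub> y \<in> N" if xy: "x \<in> N" "y \<in> N" for x y
  proof -
    obtain b b' where b: "b \<in> carrier (ext_ker \<E>)" "b' \<in> carrier (ext_ker \<E>)"
      "x = (\<ominus>\<^bsub>M\<^esub> \<phi> b, ext_incl \<E> b)" "y = (\<ominus>\<^bsub>M\<^esub> \<phi> b', ext_incl \<E> b')"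
      using N_elim[OF xy(1)] N_elim[OF xy(2)] by metis
    have "x \<oplus>\<^bsub>S\<^esub> y = (\<ominus>\<^bsub>M\<^esub> \<phi> (b \<oplus>\<^bsub>ext_ker \<E>\<^esub> b'), ext_incl \<E> (b \<oplus>\<^bsub>ext_ker \<E>\<^esub> b'))"
      using b by (simp add: S_simps \<phi>s incl_simps M.B.M.minus_add)
    then show ?thesis using N_mem b by simp
  qed
  have N_smult: "a \<odot>\<^bsub>S\<^esub> x \<in> N" if ax: "a \<in> carrier K" "x \<in> N" for a x
  proof -
    obtain b where b: "b \<in> carrier (ext_ker \<E>)" "x = (\<ominus>\<^bsub>M\<^esub> \<phi> b, ext_incl \<E> b)"
      using N_elim[OF ax(2)] by metis
    have "a \<odot>\<^bsub>S\<^esub> x = (\<ominus>\<^bsub>M\<^esub> \<phi> (a \<odot>\<^bsub>ext_ker \<E>\<^esub> b), ext_incl \<E> (a \<odot>\<^bsub>ext_ker \<E>\<^esub> b))"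
      using b that by (simp add: S_simps \<phi>s incl_simps M.B.smult_r_minus)
    then show ?thesis using N_mem b that by simp
  qed
  have N_ideal: "ideal N S"
  proof (rule idealI)
    show "ring S" by (rule S.A.ring_axioms)
    show "subgroup N (add_monoid S)"
    proof (rule S.M.add.subgroupI)
      show "N \<subseteq> carrier S" by (rule N_sub)
      show "N \<noteq> {}" using N_mem B.M.zero_closed by blast
      show "\<ominus>\<^bsub>S\<^esub> x \<in> N" if x: "x \<in> N" for x
      proof -
        have "\<ominus>\<^bsub>S\<^esub> x = (\<ominus>\<^bsub>K\<^esub> \<one>\<^bsub>K\<^esub>) \<odot>\<^bsub>S\<^esub> x"
          using subsetD[OF N_sub x] by (simp add: S.smult_l_minus)
        then show ?thesis using N_smult x by simp
      qed
    qed (rule N_add)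
    fix x y assume x: "x \<in> N" and y: "y \<in> carrier S"
    obtain b where b: "b \<in> carrier (ext_ker \<E>)" "x = (\<ominus>\<^bsub>M\<^esub> \<phi> b, ext_incl \<E> b)"
      using N_elim[OF x] by metis
    obtain m e where e: "m \<in> carrier M" "e \<in> carrier (ext_alg \<E>)" "y = (m, e)"
      using y by (auto simp: S_simps)
    have "y \<otimes>\<^bsub>S\<^esub> x = (\<ominus>\<^bsub>M\<^esub> \<phi> (left_act \<E> (ext_proj \<E> e) b), ext_incl \<E> (left_act \<E> (ext_proj \<E> e) b))"
      using b e by (simp add: S_simps l'_def r'_def proj_incl incl_left_act \<phi>_l proj_closed l_m r_0 \<phi>s l_cl)
    then show "y \<otimes>\<^bsub>S\<^esub> x \<in> N" using N_mem left_act_closed b e by simp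
    have "x \<otimes>\<^bsub>S\<^esub> y = (\<ominus>\<^bsub>M\<^esub> \<phi> (right_act \<E> b (ext_proj \<E> e)), ext_incl \<E> (right_act \<E> b (ext_proj \<E> e)))"
      using b e by (simp add: S_simps l'_def r'_def proj_incl incl_right_act \<phi>_r proj_closed r_m l_0 \<phi>s r_cl)
    then show "x \<otimes>\<^bsub>S\<^esub> y \<in> N" using N_mem right_act_closed b e by simp
  qed
  interpret N: ideal N S by (rule N_ideal)
  let ?Q = "quotient_algebra S N"
  interpret Q: unital_algebra K ?Q by (rule S.quotient_algebra[OF N_ideal])
  let ?P = "pushforward_extension M l r \<phi> \<E>"
  have P: "ext_ker ?P = M" "ext_alg ?P = ?Q" "ext_base ?P = ext_base \<E>"
    "ext_incl ?P = (\<lambda>m. N +>\<^bsub>S\<^esub> (m, \<zero>\<^bsub>ext_alg \<E>\<^esub>))"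
    "ext_proj ?P = (\<lambda>Y. the_elem ((\<lambda>(m, e). ext_proj \<E> e) ` Y))"
    by (simp_all add: pushforward_extension_def Let_def S_def N_def l'_def r'_def)
  have Q_cases: "\<exists>m \<in> carrier M. \<exists>e \<in> carrier (ext_alg \<E>). Y = N +>\<^bsub>S\<^esub> (m, e)" if "Y \<in> carrier ?Q" for Y
    using that by (auto simp: S.quotient_simps[OF N_ideal] S_simps)
  note qs = S.quotient_simps[OF N_ideal] S.quotient_smult[OF N_ideal]
  have proj: "ext_proj ?P (N +>\<^bsub>S\<^esub> (m, e)) = ext_proj \<E> e" if "m \<in> carrier M" "e \<in> carrier (ext_alg \<E>)" for m e
  proof -
    have "(\<lambda>(m, e). ext_proj \<E> e) ` (N +>\<^bsub>S\<^esub> (m, e)) = {ext_proj \<E> e}"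
    proof (intro equalityI subsetI)
      fix c assume "c \<in> (\<lambda>(m, e). ext_proj \<E> e) ` (N +>\<^bsub>S\<^esub> (m, e))"
      then obtain b where "b \<in> carrier (ext_ker \<E>)" "c = ext_proj \<E> (ext_incl \<E> b \<oplus>\<^bsub>ext_alg \<E>\<^esub> e)"
        by (auto simp: a_r_coset_def' N_def S_simps)
      then show "c \<in> {ext_proj \<E> e}"
        using that by (simp add: proj_simps(1) incl_closed proj_incl proj_closed)
    next
      have "(m, e) \<in> N +>\<^bsub>S\<^esub> (m, e)" using that N.a_rcos_self by (simp add: S_simps)
      then show "c \<in> (\<lambda>(m, e). ext_proj \<E> e) ` (N +>\<^bsub>S\<^esub> (m, e))" if "c \<in> {ext_proj \<E> e}" for c
        using that by force
    qed
    then show ?thesis by (simp add: P)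
  qed
  have coset_eq: "N +>\<^bsub>S\<^esub> (m, ext_incl \<E> b) = N +>\<^bsub>S\<^esub> (m \<oplus>\<^bsub>M\<^esub> \<phi> b, \<zero>\<^bsub>ext_alg \<E>\<^esub>)"
    if "m \<in> carrier M" "b \<in> carrier (ext_ker \<E>)" for m b
  proof -
    have "(m, ext_incl \<E> b) = (\<ominus>\<^bsub>M\<^esub> \<phi> b, ext_incl \<E> b) \<oplus>\<^bsub>S\<^esub> (m \<oplus>\<^bsub>M\<^esub> \<phi> b, \<zero>\<^bsub>ext_alg \<E>\<^esub>)"
    proof -
      have "\<ominus>\<^bsub>M\<^esub> \<phi> b \<oplus>\<^bsub>M\<^esub> (m \<oplus>\<^bsub>M\<^esub> \<phi> b) = m"
        using that \<phi>s by (simp add: M.B.M.a_comm[of m] M.B.M.r_neg1)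
      then show ?thesis using that by (simp add: S_simps incl_closed)
    qed
    then have "(m, ext_incl \<E> b) \<in> N +>\<^bsub>S\<^esub> (m \<oplus>\<^bsub>M\<^esub> \<phi> b, \<zero>\<^bsub>ext_alg \<E>\<^esub>)"
      using N_mem[OF that(2)] by (auto simp: a_r_coset_def')
    then show ?thesis
      using S.M.a_repr_independence[OF _ _ N.a_subgroup, of _ "(m \<oplus>\<^bsub>M\<^esub> \<phi> b, \<zero>\<^bsub>ext_alg \<E>\<^esub>)"] that \<phi>s
      by (auto simp: S_simps)
  qed
  show ?thesis
  proof (rule singular_extension.intro[OF field_axioms], rule singular_extension_axioms.intro)
    show "module K (ext_ker ?P)" by (simp add: P M.B.module_axioms)
    show "unital_algebra K (ext_alg ?P)" by (simp add: P Q.unital_algebra_axioms)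
    show "unital_algebra K (ext_base ?P)" by (simp add: P base_algebra)
    have "ext_proj ?P \<in> algebra_homs K ?Q (ext_base \<E>)"
      by (auto simp: algebra_homs_iff linear_maps_iff qs S_simps proj proj_closed proj_simps(1,2,4) p1
          l'_def r'_def l_cl r_cl)
    then show "ext_proj ?P \<in> algebra_homs K (ext_alg ?P) (ext_base ?P)" by (simp only: P(2,3))
    have "ext_proj ?P ` carrier ?Q = ext_proj \<E> ` carrier (ext_alg \<E>)"
    proof -
      have "ext_proj ?P ` carrier ?Q = (\<lambda>(m, e). ext_proj \<E> e) ` (carrier M \<times> carrier (ext_alg \<E>))"
        unfolding qs(1) S_simps(1) image_image by (rule image_cong) (auto simp: proj)
      also have "\<dots> = ext_proj \<E> ` carrier (ext_alg \<E>)"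
        using M.B.M.zero_closed by force
      finally show ?thesis .
    qed
    then show "ext_proj ?P ` carrier (ext_alg ?P) = carrier (ext_base ?P)"
      by (simp only: P(2,3) proj_surj)
    show "ext_incl ?P \<in> linear_maps K (ext_ker ?P) (ext_alg ?P)"
      by (auto simp: P(1,2,4) linear_maps_iff qs S_simps)
    show "inj_on (ext_incl ?P) (carrier (ext_ker ?P))"
    proof (rule inj_onI)
      fix m n assume mn: "m \<in> carrier (ext_ker ?P)" "n \<in> carrier (ext_ker ?P)" "ext_incl ?P m = ext_incl ?P n"
      then have "(m, \<zero>\<^bsub>ext_alg \<E>\<^esub>) \<in> N +>\<^bsub>S\<^esub> (n, \<zero>\<^bsub>ext_alg \<E>\<^esub>)"
        using N.a_rcos_self[of "(m, \<zero>\<^bsub>ext_alg \<E>\<^esub>)"] by (simp add: P(1,4) S_simps)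
      then obtain b where b: "b \<in> carrier (ext_ker \<E>)" "m = \<ominus>\<^bsub>M\<^esub> \<phi> b \<oplus>\<^bsub>M\<^esub> n"
        "\<zero>\<^bsub>ext_alg \<E>\<^esub> = ext_incl \<E> b \<oplus>\<^bsub>ext_alg \<E>\<^esub> \<zero>\<^bsub>ext_alg \<E>\<^esub>"
        by (auto simp: a_r_coset_def' N_def S_simps)
      then have "ext_incl \<E> b = ext_incl \<E> \<zero>\<^bsub>ext_ker \<E>\<^esub>" by (simp add: incl_closed incl_zero)
      then have "b = \<zero>\<^bsub>ext_ker \<E>\<^esub>" using b by (simp add: incl_eq_iff)
      then show "m = n" using b(2) mn by (simp add: \<phi>0 P(1))
    qed
    show "ext_incl ?P ` carrier (ext_ker ?P) = a_kernel (ext_alg ?P) (ext_base ?P) (ext_proj ?P)"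
    proof (intro equalityI subsetI)
      fix Y assume "Y \<in> ext_incl ?P ` carrier (ext_ker ?P)"
      then obtain m where "m \<in> carrier M" "Y = N +>\<^bsub>S\<^esub> (m, \<zero>\<^bsub>ext_alg \<E>\<^esub>)"
        unfolding P(1,4) by auto
      then show "Y \<in> a_kernel (ext_alg ?P) (ext_base ?P) (ext_proj ?P)"
        unfolding a_kernel_def' P(2,3) using qs(1) by (auto simp: S_simps proj proj_zero)
    next
      fix Y assume "Y \<in> a_kernel (ext_alg ?P) (ext_base ?P) (ext_proj ?P)"
      then have Y: "Y \<in> carrier ?Q" "ext_proj ?P Y = \<zero>\<^bsub>ext_base \<E>\<^esub>"
        unfolding a_kernel_def' P(2,3) by auto
      then obtain m e where me: "m \<in> carrier M" "e \<in> carrier (ext_alg \<E>)" "Y = N +>\<^bsub>S\<^esub> (m, e)"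
        using Q_cases by blast
      then have "ext_proj \<E> e = \<zero>\<^bsub>ext_base \<E>\<^esub>" using Y(2) proj by simp
      then obtain b where b: "b \<in> carrier (ext_ker \<E>)" "e = ext_incl \<E> b"
        using me(2) proj_eq_zero by blast
      then have "Y = ext_incl ?P (m \<oplus>\<^bsub>M\<^esub> \<phi> b)" using me coset_eq by (simp add: P(4))
      then show "Y \<in> ext_incl ?P ` carrier (ext_ker ?P)"
        using me b \<phi>s by (auto simp: P(1))
    qed
    show "ext_incl ?P m \<otimes>\<^bsub>ext_alg ?P\<^esub> ext_incl ?P n = \<zero>\<^bsub>ext_alg ?P\<^esub>"
      if "m \<in> carrier (ext_ker ?P)" "n \<in> carrier (ext_ker ?P)" for m n
      using that by (simp add: P(1,2,4) qs S_simps l'_def r'_def proj_zero l_0 r_0)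
  qed
qed

end


section \<open>Crossed homomorphisms and their action\<close>

definition crossed_homs ::
  "('k, 'n) ring_scheme \<Rightarrow> ('k, 'c) module \<Rightarrow> ('k, 'b) module
    \<Rightarrow> ('c \<Rightarrow> 'b \<Rightarrow> 'b) \<Rightarrow> ('b \<Rightarrow> 'c \<Rightarrow> 'b) \<Rightarrow> ('c \<Rightarrow> 'b) monoid"
  where "crossed_homs K C B l r =
    \<lparr>carrier = {\<sigma> \<in> extensional (carrier C). \<sigma> \<in> linear_maps K C B \<and>
       (\<forall>c \<in> carrier C. \<forall>c' \<in> carrier C. \<sigma> (c \<otimes>\<^bsub>C\<^esub> c') = l c (\<sigma> c') \<oplus>\<^bsub>B\<^esub> r (\<sigma> c) c')},
     mult = (\<lambda>\<sigma> \<tau>. \<lambda>c \<in> carrier C. \<sigma> c \<oplus>\<^bsub>B\<^esub> \<tau> c),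
     one = (\<lambda>c \<in> carrier C. \<zero>\<^bsub>B\<^esub>)\<rparr>"

text \<open>
  The action \<open>\<sigma> \<cdot> \<epsilon> = k' \<circ> \<sigma> \<circ> f + \<epsilon>\<close>, in the format of \<^locale>\<open>group_action\<close>.
\<close>

definition crossed_homs_act ::
  "('k, 'n) ring_scheme \<Rightarrow> ('c \<Rightarrow> 'd) \<Rightarrow> ('b \<Rightarrow> 'a)
    \<Rightarrow> ('k, 'b, 'e, 'c) extension \<Rightarrow> ('k, 'a, 'f, 'd) extension
    \<Rightarrow> ('c \<Rightarrow> 'a) \<Rightarrow> ('e \<Rightarrow> 'f) \<Rightarrow> ('e \<Rightarrow> 'f)"
  where "crossed_homs_act K \<phi>\<^sub>0 \<phi>\<^sub>1 \<E> \<E>' \<sigma> =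
    (\<lambda>\<epsilon> \<in> OPEXT K \<phi>\<^sub>0 \<phi>\<^sub>1 \<E> \<E>'. \<lambda>e \<in> carrier (ext_alg \<E>).
      ext_incl \<E>' (\<sigma> (ext_proj \<E> e)) \<oplus>\<^bsub>ext_alg \<E>'\<^esub> \<epsilon> e)"

definition simply_transitive_action :: "('g, 'n) monoid_scheme \<Rightarrow> 'x set \<Rightarrow> ('g \<Rightarrow> 'x \<Rightarrow> 'x) \<Rightarrow> bool"
  where "simply_transitive_action G S \<psi> \<longleftrightarrow>
    group_action G S \<psi> \<and> (\<forall>x \<in> S. \<forall>y \<in> S. \<exists>!g. g \<in> carrier G \<and> \<psi> g x = y)"

end

theory Submission
  imports Defs
begin

text \<open>
  Morphisms \<open>E \<rightarrow> E'\<close> inducing \<open>(\<phi>\<^sub>0, \<phi>\<^sub>1)\<close> correspond to morphisms from the push forward \<open>\<phi>\<^sub>1\<^sub>*E\<close> to the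
  pullback \<open>\<phi>\<^sub>0\<^sup>*E'\<close> that are the identity on \<open>B'\<close> and \<open>C\<close>, by the two universal properties; such a
  morphism is bijective by the short five lemma. For two morphisms \<open>\<epsilon>, \<delta>\<close> inducing \<open>(\<phi>\<^sub>0, \<phi>\<^sub>1)\<close> the
  difference \<open>\<delta> - \<epsilon>\<close> takes values in \<open>k'(B')\<close> and vanishes on \<open>k(B)\<close>, so it is \<open>k' \<circ> \<sigma> \<circ> f\<close> for a
  unique \<open>\<sigma>\<close>, and multiplicativity of \<open>\<delta>\<close> amounts to the cocycle identity because \<open>k'(B')\<^sup>2 = 0\<close>.
\<close>

section \<open>Morphisms of extensions and the pullback\<close>

lemma linear_maps_zero:
  assumes "h \<in> linear_maps K M N" "module K M" "module K N"
  shows "h \<zero>\<^bsub>M\<^esub> = \<zero>\<^bsub>N\<^esub>"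
proof -
  interpret M: module K M by (rule assms)
  interpret N: module K N by (rule assms)
  have "h (\<zero>\<^bsub>K\<^esub> \<odot>\<^bsub>M\<^esub> \<zero>\<^bsub>M\<^esub>) = \<zero>\<^bsub>K\<^esub> \<odot>\<^bsub>N\<^esub> h \<zero>\<^bsub>M\<^esub>" "h \<zero>\<^bsub>M\<^esub> \<in> carrier N"
    using assms(1) M.M.zero_closed M.R.zero_closed unfolding linear_maps_iff by blast+
  then show ?thesis by simp
qed

lemma linear_maps_minus:
  assumes "h \<in> linear_maps K M N" "module K M" "module K N" "x \<in> carrier M"
  shows "h (\<ominus>\<^bsub>M\<^esub> x) = \<ominus>\<^bsub>N\<^esub> h x"
proof -
  interpret M: module K M by (rule assms)
  interpret N: module K N by (rule assms)
  have "h (\<ominus>\<^bsub>M\<^esub> x) \<oplus>\<^bsub>N\<^esub> h x = h (\<ominus>\<^bsub>M\<^esub> x \<oplus>\<^bsub>M\<^esub> x)" "h x \<in> carrier N" "h (\<ominus>\<^bsub>M\<^esub> x) \<in> carrier N"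
    using assms(1,4) by (simp_all add: linear_maps_iff)
  then show ?thesis
    using linear_maps_zero[OF assms(1-3)] assms(4) by (simp add: M.M.l_neg N.M.minus_equality)
qed

text \<open>Serves twice: along \<open>\<phi>\<^sub>0\<close> it makes \<open>B'\<close> a
  \<open>C\<close>-bimodule, and along the projection of an extension it lets the middle algebra act
  on a bimodule over the base, as the semidirect sum requires.\<close>

lemma bimodule_restrict_scalars:
  assumes "bimodule K C' B l r" "unital_algebra K C" "\<phi> \<in> algebra_homs K C C'"
  shows "bimodule K C B (\<lambda>c. l (\<phi> c)) (\<lambda>b c. r b (\<phi> c))"
proof -
  interpret B: bimodule K C' B l r by (rule assms)
  interpret C: unital_algebra K C by (rule assms)
  have \<phi>: "c \<in> carrier C \<Longrightarrow> \<phi> c \<in> carrier C'" for c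
    using assms(3) by (simp add: algebra_homs_iff linear_maps_iff)
  show ?thesis
    using B.l_linear B.l_linear' B.r_linear B.r_linear' assms(3)
    by unfold_locales
      (simp_all add: \<phi> algebra_homs_iff linear_maps_iff B.l_one B.r_one B.l_mult B.r_mult B.l_r)
qed

lemma extension_morphism_comp:
  "\<lbrakk>extension_morphism K \<E>' \<E>'' \<beta>' \<epsilon>' \<gamma>'; extension_morphism K \<E> \<E>' \<beta> \<epsilon> \<gamma>\<rbrakk>
    \<Longrightarrow> extension_morphism K \<E> \<E>'' (\<lambda>b. \<beta>' (\<beta> b)) (\<lambda>e. \<epsilon>' (\<epsilon> e)) (\<lambda>c. \<gamma>' (\<gamma> c))"
  by (simp add: extension_morphism_def algebra_homs_iff linear_maps_iff)

context singular_extension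
begin

text \<open>As sublocales the three structures persist in every later interpretation, under names
  such as \<open>X.B\<close> and \<open>X.E\<close>.\<close>

sublocale B: module K "ext_ker \<E>" by (rule ker_module)
sublocale E: unital_algebra K "ext_alg \<E>" by (rule alg_algebra)
sublocale C: unital_algebra K "ext_base \<E>" by (rule base_algebra)

lemma proj_one: "ext_proj \<E> \<one>\<^bsub>ext_alg \<E>\<^esub> = \<one>\<^bsub>ext_base \<E>\<^esub>"
  by (rule proj_simps(3)[OF E.M.zero_closed E.M.zero_closed])

lemma incl_smult: "\<lbrakk>a \<in> carrier K; b \<in> carrier (ext_ker \<E>)\<rbrakk> \<Longrightarrow>
  ext_incl \<E> (a \<odot>\<^bsub>ext_ker \<E>\<^esub> b) = a \<odot>\<^bsub>ext_alg \<E>\<^esub> ext_incl \<E> b"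
  by (rule incl_simps(2)[OF _ B.M.zero_closed])

end

text \<open>Elements of the middle algebra with equal projection differ by an element of the kernel
  (\<open>same_proj\<close>). Hence \<epsilon> acts on each fibre of the projection as a translate
  of \<beta>, while \<gamma> matches the fibres.\<close>

lemma short_five:
  assumes "singular_extension K \<E>" "singular_extension K \<E>'"
    and m: "extension_morphism K \<E> \<E>' \<beta> \<epsilon> \<gamma>"
    and \<beta>: "bij_betw \<beta> (carrier (ext_ker \<E>)) (carrier (ext_ker \<E>'))"
    and \<gamma>: "bij_betw \<gamma> (carrier (ext_base \<E>)) (carrier (ext_base \<E>'))"
  shows "bij_betw \<epsilon> (carrier (ext_alg \<E>)) (carrier (ext_alg \<E>'))"
proof -
  interpret X: singular_extension K \<E> by fact
  interpret Y: singular_extension K \<E>' by fact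
  note \<beta>l = m[unfolded extension_morphism_def, THEN conjunct1]
  have cl: "\<And>e. e \<in> carrier (ext_alg \<E>) \<Longrightarrow> \<epsilon> e \<in> carrier (ext_alg \<E>')"
    and ad: "\<And>e b. \<lbrakk>e \<in> carrier (ext_alg \<E>); b \<in> carrier (ext_ker \<E>)\<rbrakk>
      \<Longrightarrow> \<epsilon> (e \<oplus>\<^bsub>ext_alg \<E>\<^esub> ext_incl \<E> b) = \<epsilon> e \<oplus>\<^bsub>ext_alg \<E>'\<^esub> ext_incl \<E>' (\<beta> b)"
    and pr: "\<And>e. e \<in> carrier (ext_alg \<E>) \<Longrightarrow> ext_proj \<E>' (\<epsilon> e) = \<gamma> (ext_proj \<E> e)"
    and bcl: "\<And>b. b \<in> carrier (ext_ker \<E>) \<Longrightarrow> \<beta> b \<in> carrier (ext_ker \<E>')"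
    using m by (simp_all add: extension_morphism_def algebra_homs_iff linear_maps_iff X.incl_closed)
  show ?thesis
  proof (rule bij_betw_imageI)
    show "inj_on \<epsilon> (carrier (ext_alg \<E>))"
    proof (rule inj_onI)
      fix x y assume xy: "x \<in> carrier (ext_alg \<E>)" "y \<in> carrier (ext_alg \<E>)" "\<epsilon> x = \<epsilon> y"
      then have "ext_proj \<E> x = ext_proj \<E> y"
        using bij_betw_imp_inj_on[OF \<gamma>] pr X.proj_closed by (metis inj_onD)
      then obtain b where b: "b \<in> carrier (ext_ker \<E>)" "y = x \<oplus>\<^bsub>ext_alg \<E>\<^esub> ext_incl \<E> b"
        using X.same_proj xy(1,2) by blast
      then have "\<epsilon> x = \<epsilon> x \<oplus>\<^bsub>ext_alg \<E>'\<^esub> ext_incl \<E>' (\<beta> b)"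
        using xy ad by simp
      then have "ext_incl \<E>' (\<beta> b) = \<zero>\<^bsub>ext_alg \<E>'\<^esub>"
        using Y.E.M.add.l_cancel_one'[OF cl[OF xy(1)] Y.incl_closed[OF bcl[OF b(1)]]] by blast
      then have "\<beta> b = \<zero>\<^bsub>ext_ker \<E>'\<^esub>"
        using Y.incl_zero b(1) bcl by (intro Y.ker_eqI) auto
      then have "\<beta> b = \<beta> \<zero>\<^bsub>ext_ker \<E>\<^esub>"
        using linear_maps_zero[OF \<beta>l X.ker_module Y.ker_module] by simp
      then have "b = \<zero>\<^bsub>ext_ker \<E>\<^esub>"
        using bij_betw_imp_inj_on[OF \<beta>] b(1) X.B.M.zero_closed by (metis inj_onD)
      then show "x = y" using b(2) xy(1) X.incl_zero by simp
    qed
    show "\<epsilon> ` carrier (ext_alg \<E>) = carrier (ext_alg \<E>')"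
    proof (intro equalityI subsetI)
      fix y assume y: "y \<in> carrier (ext_alg \<E>')"
      obtain c where "c \<in> carrier (ext_base \<E>)" "ext_proj \<E>' y = \<gamma> c"
        using Y.proj_closed[OF y] bij_betw_imp_surj_on[OF \<gamma>] by (metis imageE)
      then obtain e where e: "e \<in> carrier (ext_alg \<E>)" "ext_proj \<E>' (\<epsilon> e) = ext_proj \<E>' y"
        using X.base_elem pr by metis
      obtain b' where "b' \<in> carrier (ext_ker \<E>')" "y = \<epsilon> e \<oplus>\<^bsub>ext_alg \<E>'\<^esub> ext_incl \<E>' b'"
        using Y.same_proj[OF cl[OF e(1)] y e(2)] by blast
      \<comment> \<open>Surjectivity of \<beta> lets the correction \<open>b'\<close> be absorbed
        into the argument of \<epsilon>.\<close>
      moreover from this(1) obtain b where b: "b \<in> carrier (ext_ker \<E>)" "b' = \<beta> b"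
        using bij_betw_imp_surj_on[OF \<beta>] by (metis imageE)
      ultimately have "y = \<epsilon> (e \<oplus>\<^bsub>ext_alg \<E>\<^esub> ext_incl \<E> b)"
        using ad[OF e(1) b(1)] by simp
      then show "y \<in> \<epsilon> ` carrier (ext_alg \<E>)"
        using X.E.M.a_closed[OF e(1) X.incl_closed[OF b(1)]] by (rule image_eqI)
    qed (auto intro: cl)
  qed
qed

text \<open>The inverse of a bijective morphism is again a morphism. This is used because
  equivalence is stated from the pullback to the push forward, whereas the universal properties
  yield a map in the opposite direction.\<close>

lemma equivalent_extensions_sym:
  assumes "singular_extension K \<E>" "singular_extension K \<E>'" "equivalent_extensions K \<E> \<E>'"
  shows "equivalent_extensions K \<E>' \<E>"
proof -
  interpret X: singular_extension K \<E> by fact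
  interpret Y: singular_extension K \<E>' by fact
  obtain \<epsilon> where eq: "ext_ker \<E> = ext_ker \<E>'" "ext_base \<E> = ext_base \<E>'"
    and m: "extension_morphism K \<E> \<E>' id \<epsilon> id"
    and bij: "bij_betw \<epsilon> (carrier (ext_alg \<E>)) (carrier (ext_alg \<E>'))"
    using assms(3) unfolding equivalent_extensions_def by blast
  define \<delta> where "\<delta> = inv_into (carrier (ext_alg \<E>)) \<epsilon>"
  have \<delta>: "\<delta> (\<epsilon> e) = e" if "e \<in> carrier (ext_alg \<E>)" for e
    unfolding \<delta>_def by (rule bij_betw_inv_into_left[OF bij that])
  \<comment> \<open>The equations for the operations are turned so that \<epsilon> is outermost on
    the right. Once \<open>ball\<close> has written each element of the target as
    \<open>\<epsilon> x\<close>, the rule \<open>\<delta> (\<epsilon> x) = x\<close> settles the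
    conditions on \<delta>.\<close>
  have \<epsilon>: "\<And>x. x \<in> carrier (ext_alg \<E>) \<Longrightarrow> \<epsilon> x \<in> carrier (ext_alg \<E>')"
    "\<And>x y. \<lbrakk>x \<in> carrier (ext_alg \<E>); y \<in> carrier (ext_alg \<E>)\<rbrakk>
      \<Longrightarrow> \<epsilon> x \<oplus>\<^bsub>ext_alg \<E>'\<^esub> \<epsilon> y = \<epsilon> (x \<oplus>\<^bsub>ext_alg \<E>\<^esub> y)"
    "\<And>x y. \<lbrakk>x \<in> carrier (ext_alg \<E>); y \<in> carrier (ext_alg \<E>)\<rbrakk>
      \<Longrightarrow> \<epsilon> x \<otimes>\<^bsub>ext_alg \<E>'\<^esub> \<epsilon> y = \<epsilon> (x \<otimes>\<^bsub>ext_alg \<E>\<^esub> y)"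
    "\<And>a x. \<lbrakk>a \<in> carrier K; x \<in> carrier (ext_alg \<E>)\<rbrakk>
      \<Longrightarrow> a \<odot>\<^bsub>ext_alg \<E>'\<^esub> \<epsilon> x = \<epsilon> (a \<odot>\<^bsub>ext_alg \<E>\<^esub> x)"
    "\<one>\<^bsub>ext_alg \<E>'\<^esub> = \<epsilon> \<one>\<^bsub>ext_alg \<E>\<^esub>"
    "\<And>b. b \<in> carrier (ext_ker \<E>) \<Longrightarrow> ext_incl \<E>' b = \<epsilon> (ext_incl \<E> b)"
    "\<And>x. x \<in> carrier (ext_alg \<E>) \<Longrightarrow> ext_proj \<E>' (\<epsilon> x) = ext_proj \<E> x"
    using m by (simp_all add: extension_morphism_def algebra_homs_iff linear_maps_iff)
  have ball: "(\<forall>y \<in> carrier (ext_alg \<E>'). P y) \<longleftrightarrow> (\<forall>x \<in> carrier (ext_alg \<E>). P (\<epsilon> x))" for P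
    unfolding bij_betw_imp_surj_on[OF bij, symmetric] by simp
  have "extension_morphism K \<E>' \<E> id \<delta> id"
    by (simp add: extension_morphism_def algebra_homs_iff linear_maps_iff ball eq[symmetric] \<delta> \<epsilon>
        X.incl_closed)
  then show ?thesis
    using bij_betw_inv_into[OF bij] eq unfolding equivalent_extensions_def \<delta>_def by auto
qed

section \<open>The fibre product: its projection, its universal map and its induced actions\<close>

lemma pullback_extension_simps:
  "ext_ker (pullback_extension D \<phi> \<E>) = ext_ker \<E>"
  "ext_base (pullback_extension D \<phi> \<E>) = D"
  "ext_incl (pullback_extension D \<phi> \<E>) b = (ext_incl \<E> b, \<zero>\<^bsub>D\<^esub>)"
  "ext_proj (pullback_extension D \<phi> \<E>) x = snd x"
  "(e, c) \<in> carrier (ext_alg (pullback_extension D \<phi> \<E>)) \<longleftrightarrow>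
    e \<in> carrier (ext_alg \<E>) \<and> c \<in> carrier D \<and> ext_proj \<E> e = \<phi> c"
  "(e, c) \<oplus>\<^bsub>ext_alg (pullback_extension D \<phi> \<E>)\<^esub> (e', c') = (e \<oplus>\<^bsub>ext_alg \<E>\<^esub> e', c \<oplus>\<^bsub>D\<^esub> c')"
  "(e, c) \<otimes>\<^bsub>ext_alg (pullback_extension D \<phi> \<E>)\<^esub> (e', c') = (e \<otimes>\<^bsub>ext_alg \<E>\<^esub> e', c \<otimes>\<^bsub>D\<^esub> c')"
  "a \<odot>\<^bsub>ext_alg (pullback_extension D \<phi> \<E>)\<^esub> (e, c) = (a \<odot>\<^bsub>ext_alg \<E>\<^esub> e, a \<odot>\<^bsub>D\<^esub> c)"
  "\<one>\<^bsub>ext_alg (pullback_extension D \<phi> \<E>)\<^esub> = (\<one>\<^bsub>ext_alg \<E>\<^esub>, \<one>\<^bsub>D\<^esub>)"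
  by (simp_all add: pullback_extension_def)

lemma pullback_projection:
  assumes "\<phi> \<in> algebra_homs K D (ext_base \<E>)"
  shows "extension_morphism K (pullback_extension D \<phi> \<E>) \<E> id fst \<phi>"
  using assms by (auto simp: extension_morphism_def algebra_homs_iff linear_maps_iff pullback_extension_simps)

text \<open>The pair lies in the fibre product because \<open>\<epsilon> e\<close> projects to
  \<gamma> of the projection of \<open>e\<close>. This trades a morphism over \<gamma> for one that
  is the identity on the base, where the push forward applies.\<close>

lemma pullback_universal:
  assumes "singular_extension K \<E>" "extension_morphism K \<E> \<E>' \<beta> \<epsilon> \<gamma>"
  shows "extension_morphism K \<E> (pullback_extension (ext_base \<E>) \<gamma> \<E>') \<beta> (\<lambda>e. (\<epsilon> e, ext_proj \<E> e)) id"
proof -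
  interpret singular_extension K \<E> by fact
  show ?thesis
    using assms(2)
    by (auto simp: extension_morphism_def algebra_homs_iff linear_maps_iff pullback_extension_simps
      proj_closed proj_simps(1,2,4) proj_one proj_incl)
qed

text \<open>An action may be computed with any lift of the base element; for \<open>c\<close> take
  \<open>(e, c)\<close> with \<open>e\<close> over \<open>\<phi> c\<close>, which moves the
  computation to the middle algebra of \<open>\<E>\<close>. The bimodule induced by the pullback is
  thus the one restricted along \<phi>, as \<open>pushforward_universal\<close> demands.\<close>

lemma pullback_act:
  assumes "singular_extension K \<E>" and D: "unital_algebra K D" and \<phi>: "\<phi> \<in> algebra_homs K D (ext_base \<E>)"
    and c: "c \<in> carrier D" and b: "b \<in> carrier (ext_ker \<E>)"
  shows "left_act (pullback_extension D \<phi> \<E>) c b = left_act \<E> (\<phi> c) b"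
    and "right_act (pullback_extension D \<phi> \<E>) b c = right_act \<E> b (\<phi> c)"
proof -
  interpret singular_extension K \<E> by fact
  interpret D: unital_algebra K D by (rule D)
  interpret P: singular_extension K "pullback_extension D \<phi> \<E>" by (rule pullback_singular[OF D \<phi>])
  have "\<phi> c \<in> carrier (ext_base \<E>)" using \<phi> c by (simp add: algebra_homs_iff linear_maps_iff)
  then obtain e where e: "e \<in> carrier (ext_alg \<E>)" "\<phi> c = ext_proj \<E> e" by (rule base_elem)
  then have P: "(e, c) \<in> carrier (ext_alg (pullback_extension D \<phi> \<E>))"
    using c by (simp add: pullback_extension_simps)
  note s = P.incl_left_act[OF P, of b] P.left_act_closed[OF P, of b]
    P.incl_right_act[OF P, of b] P.right_act_closed[OF P, of b]
  show "left_act (pullback_extension D \<phi> \<E>) c b = left_act \<E> (\<phi> c) b"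
    using s b e by (intro ker_eqI) (simp_all add: pullback_extension_simps incl_left_act left_act_closed)
  show "right_act (pullback_extension D \<phi> \<E>) b c = right_act \<E> b (\<phi> c)"
    using s b e by (intro ker_eqI) (simp_all add: pullback_extension_simps incl_right_act right_act_closed)
qed

section \<open>The universal property of the push forward\<close>

text \<open>Collects the hypotheses of \<open>pushforward_singular\<close>, so that the semidirect
  sum and the ideal bound by the \<open>let\<close> of \<open>pushforward_extension\<close> become
  the constants \<open>S\<close> and \<open>N\<close>.\<close>

locale pushforward = singular_extension K \<E> + M: bimodule K "ext_base \<E>" M l r
  for K :: "('k, 'n) ring_scheme" (structure) and \<E> :: "('k, 'b, 'e, 'c) extension"
    and M :: "('k, 'a) module" and l r +
  fixes \<phi> :: "'b \<Rightarrow> 'a"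
  assumes \<phi>_linear: "\<phi> \<in> linear_maps K (ext_ker \<E>) M"
    and \<phi>_l: "\<lbrakk>c \<in> carrier (ext_base \<E>); b \<in> carrier (ext_ker \<E>)\<rbrakk>
      \<Longrightarrow> \<phi> (left_act \<E> c b) = l c (\<phi> b)"
    and \<phi>_r: "\<lbrakk>c \<in> carrier (ext_base \<E>); b \<in> carrier (ext_ker \<E>)\<rbrakk>
      \<Longrightarrow> \<phi> (right_act \<E> b c) = r (\<phi> b) c"
begin

abbreviation "P \<equiv> pushforward_extension M l r \<phi> \<E>"

definition "S = semidirect_sum M (ext_alg \<E>)
  (\<lambda>e m. l (ext_proj \<E> e) m) (\<lambda>m e. r m (ext_proj \<E> e))"

definition "N = {(\<ominus>\<^bsub>M\<^esub> \<phi> b, ext_incl \<E> b) | b. b \<in> carrier (ext_ker \<E>)}"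

sublocale P: singular_extension K P
  by (rule pushforward_singular[OF M.bimodule_axioms \<phi>_linear \<phi>_l \<phi>_r])

sublocale S: unital_algebra K S
  unfolding S_def
  by (rule bimodule.semidirect_sum_algebra,
      rule bimodule_restrict_scalars[OF M.bimodule_axioms alg_algebra proj_hom])

lemma P_simps: "ext_ker P = M" "ext_alg P = quotient_algebra S N" "ext_base P = ext_base \<E>"
  "ext_incl P = (\<lambda>m. N +>\<^bsub>S\<^esub> (m, \<zero>\<^bsub>ext_alg \<E>\<^esub>))"
  by (simp_all add: pushforward_extension_def Let_def S_def N_def)

lemma S_simps: "carrier S = carrier M \<times> carrier (ext_alg \<E>)" "\<zero>\<^bsub>S\<^esub> = (\<zero>\<^bsub>M\<^esub>, \<zero>\<^bsub>ext_alg \<E>\<^esub>)"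
  "\<one>\<^bsub>S\<^esub> = (\<zero>\<^bsub>M\<^esub>, \<one>\<^bsub>ext_alg \<E>\<^esub>)"
  "(m, e) \<oplus>\<^bsub>S\<^esub> (n, d) = (m \<oplus>\<^bsub>M\<^esub> n, e \<oplus>\<^bsub>ext_alg \<E>\<^esub> d)"
  "(m, e) \<otimes>\<^bsub>S\<^esub> (n, d) = (l (ext_proj \<E> e) n \<oplus>\<^bsub>M\<^esub> r m (ext_proj \<E> d), e \<otimes>\<^bsub>ext_alg \<E>\<^esub> d)"
  "a \<odot>\<^bsub>S\<^esub> (m, e) = (a \<odot>\<^bsub>M\<^esub> m, a \<odot>\<^bsub>ext_alg \<E>\<^esub> e)"
  by (simp_all add: S_def semidirect_sum_def)

lemma act_simps:
  assumes "c \<in> carrier (ext_base \<E>)" "m \<in> carrier M"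
  shows "l c m \<in> carrier M" "r m c \<in> carrier M"
    "l \<zero>\<^bsub>ext_base \<E>\<^esub> m = \<zero>\<^bsub>M\<^esub>" "r m \<zero>\<^bsub>ext_base \<E>\<^esub> = \<zero>\<^bsub>M\<^esub>"
    "l c \<zero>\<^bsub>M\<^esub> = \<zero>\<^bsub>M\<^esub>" "r \<zero>\<^bsub>M\<^esub> c = \<zero>\<^bsub>M\<^esub>"
    "l c (\<ominus>\<^bsub>M\<^esub> m) = \<ominus>\<^bsub>M\<^esub> l c m" "r (\<ominus>\<^bsub>M\<^esub> m) c = \<ominus>\<^bsub>M\<^esub> r m c"
  using M.l_linear[OF assms(1)] M.r_linear[OF assms(1)] assms(2)
    linear_maps_zero[OF M.l_linear'[OF assms(2)] C.module_axioms M.B.module_axioms]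
    linear_maps_zero[OF M.r_linear'[OF assms(2)] C.module_axioms M.B.module_axioms]
    linear_maps_zero[OF M.l_linear[OF assms(1)] M.B.module_axioms M.B.module_axioms]
    linear_maps_zero[OF M.r_linear[OF assms(1)] M.B.module_axioms M.B.module_axioms]
    linear_maps_minus[OF M.l_linear[OF assms(1)] M.B.module_axioms M.B.module_axioms assms(2)]
    linear_maps_minus[OF M.r_linear[OF assms(1)] M.B.module_axioms M.B.module_axioms assms(2)]
  by (simp_all add: linear_maps_iff)

lemma \<phi>_closed: "b \<in> carrier (ext_ker \<E>) \<Longrightarrow> \<phi> b \<in> carrier M"
  using \<phi>_linear by (simp add: linear_maps_iff)

text \<open>In a product of \<open>(m, e)\<close> with the element of \<open>N\<close> given by
  \<open>b\<close>, the term containing \<open>m\<close> vanishes because the included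
  \<open>b\<close> projects to zero. What is left is the element of \<open>N\<close> given by the
  action of the projection of \<open>e\<close> on \<open>b\<close>, since \<phi> respects the
  actions.\<close>

lemma N_ideal: "ideal N S"
proof (rule idealI)
  show "ring S" by (rule S.A.ring_axioms)
  have N_mem: "(\<ominus>\<^bsub>M\<^esub> \<phi> b, ext_incl \<E> b) \<in> N" if "b \<in> carrier (ext_ker \<E>)" for b
    using that unfolding N_def by blast
  have N_sub: "N \<subseteq> carrier S"
    by (auto simp: N_def S_simps \<phi>_closed incl_closed)
  show "subgroup N (add_monoid S)"
  proof (rule S.M.add.subgroupI)
    show "N \<subseteq> carrier S" by (rule N_sub)
    show "N \<noteq> {}" using N_mem B.M.zero_closed by blast
    fix x assume x: "x \<in> N"
    then obtain b where b: "b \<in> carrier (ext_ker \<E>)" "x = (\<ominus>\<^bsub>M\<^esub> \<phi> b, ext_incl \<E> b)"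
      unfolding N_def by blast
    \<comment> \<open>\<open>S_simps\<close> describes scalar multiples by components but not
      negatives; hence the scalar minus one.\<close>
    have "\<ominus>\<^bsub>S\<^esub> x = (\<ominus>\<^bsub>K\<^esub> \<one>\<^bsub>K\<^esub>) \<odot>\<^bsub>S\<^esub> x"
      using subsetD[OF N_sub x] by (simp add: S.smult_l_minus)
    also have "\<dots> = (\<ominus>\<^bsub>M\<^esub> \<phi> (\<ominus>\<^bsub>ext_ker \<E>\<^esub> b), ext_incl \<E> (\<ominus>\<^bsub>ext_ker \<E>\<^esub> b))"
      using b linear_maps_minus[OF \<phi>_linear ker_module M.B.module_axioms b(1)]
        linear_maps_minus[OF incl_linear ker_module E.module_axioms b(1)]
      by (simp add: S_simps M.B.smult_l_minus E.smult_l_minus \<phi>_closed incl_closed)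
    finally show "\<ominus>\<^bsub>S\<^esub> x \<in> N" using N_mem b(1) by simp
    fix y assume "y \<in> N"
    then obtain b' where b': "b' \<in> carrier (ext_ker \<E>)" "y = (\<ominus>\<^bsub>M\<^esub> \<phi> b', ext_incl \<E> b')"
      unfolding N_def by blast
    have "x \<oplus>\<^bsub>S\<^esub> y = (\<ominus>\<^bsub>M\<^esub> \<phi> (b \<oplus>\<^bsub>ext_ker \<E>\<^esub> b'), ext_incl \<E> (b \<oplus>\<^bsub>ext_ker \<E>\<^esub> b'))"
      using b b' \<phi>_linear by (simp add: S_simps linear_maps_iff incl_simps M.B.M.minus_add)
    then show "x \<oplus>\<^bsub>S\<^esub> y \<in> N" using N_mem b b' by simp
  qed
  fix x y assume x: "x \<in> N" and y: "y \<in> carrier S"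
  obtain b where b: "b \<in> carrier (ext_ker \<E>)" "x = (\<ominus>\<^bsub>M\<^esub> \<phi> b, ext_incl \<E> b)"
    using x unfolding N_def by blast
  obtain m e where e: "m \<in> carrier M" "e \<in> carrier (ext_alg \<E>)" "y = (m, e)"
    using y by (auto simp: S_simps)
  note s = S_simps proj_incl incl_left_act incl_right_act \<phi>_l \<phi>_r proj_closed \<phi>_closed act_simps
    act_simps(3,4)[OF C.M.zero_closed]
  have "y \<otimes>\<^bsub>S\<^esub> x = (\<ominus>\<^bsub>M\<^esub> \<phi> (left_act \<E> (ext_proj \<E> e) b), ext_incl \<E> (left_act \<E> (ext_proj \<E> e) b))"
    using b e by (simp add: s)
  then show "y \<otimes>\<^bsub>S\<^esub> x \<in> N" using N_mem left_act_closed b e by simp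
  have "x \<otimes>\<^bsub>S\<^esub> y = (\<ominus>\<^bsub>M\<^esub> \<phi> (right_act \<E> b (ext_proj \<E> e)), ext_incl \<E> (right_act \<E> b (ext_proj \<E> e)))"
    using b e by (simp add: s)
  then show "x \<otimes>\<^bsub>S\<^esub> y \<in> N" using N_mem right_act_closed b e by simp
qed

sublocale N: ideal N S by (rule N_ideal)

lemmas Q_simps = S.quotient_simps[OF N_ideal] S.quotient_smult[OF N_ideal]

text \<open>Second components within a coset differ only by elements of the included kernel, which
  project to zero; so \<open>the_elem\<close> is applied to a singleton.\<close>

lemma P_proj:
  assumes "m \<in> carrier M" "e \<in> carrier (ext_alg \<E>)"
  shows "ext_proj P (N +>\<^bsub>S\<^esub> (m, e)) = ext_proj \<E> e"
proof -
  have "(\<lambda>(m, e). ext_proj \<E> e) ` (N +>\<^bsub>S\<^esub> (m, e)) = {ext_proj \<E> e}"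
  proof (intro equalityI subsetI)
    fix c assume "c \<in> (\<lambda>(m, e). ext_proj \<E> e) ` (N +>\<^bsub>S\<^esub> (m, e))"
    then obtain b where "b \<in> carrier (ext_ker \<E>)" "c = ext_proj \<E> (ext_incl \<E> b \<oplus>\<^bsub>ext_alg \<E>\<^esub> e)"
      by (auto simp: a_r_coset_def' N_def S_simps)
    then show "c \<in> {ext_proj \<E> e}"
      using assms by (simp add: proj_simps(1) incl_closed proj_incl proj_closed)
  next
    have "(m, e) \<in> N +>\<^bsub>S\<^esub> (m, e)" using assms N.a_rcos_self by (simp add: S_simps)
    then show "c \<in> (\<lambda>(m, e). ext_proj \<E> e) ` (N +>\<^bsub>S\<^esub> (m, e))" if "c \<in> {ext_proj \<E> e}" for c
      using that by force
  qed
  then show ?thesis by (simp add: pushforward_extension_def Let_def)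
qed

text \<open>The two representatives differ by the element of \<open>N\<close> belonging to
  \<open>b\<close>. This makes the left square of \<open>pushforward_lift\<close> commute.\<close>

lemma coset_incl:
  assumes "b \<in> carrier (ext_ker \<E>)"
  shows "N +>\<^bsub>S\<^esub> (\<zero>\<^bsub>M\<^esub>, ext_incl \<E> b) = N +>\<^bsub>S\<^esub> (\<phi> b, \<zero>\<^bsub>ext_alg \<E>\<^esub>)"
proof -
  have "(\<zero>\<^bsub>M\<^esub>, ext_incl \<E> b) = (\<ominus>\<^bsub>M\<^esub> \<phi> b, ext_incl \<E> b) \<oplus>\<^bsub>S\<^esub> (\<phi> b, \<zero>\<^bsub>ext_alg \<E>\<^esub>)"
    using assms by (simp add: S_simps \<phi>_closed incl_closed M.B.M.l_neg)
  then have "(\<zero>\<^bsub>M\<^esub>, ext_incl \<E> b) \<in> N +>\<^bsub>S\<^esub> (\<phi> b, \<zero>\<^bsub>ext_alg \<E>\<^esub>)"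
    using assms by (auto simp: a_r_coset_def' N_def)
  then show ?thesis
    using S.M.a_repr_independence[OF _ _ N.a_subgroup, of _ "(\<phi> b, \<zero>\<^bsub>ext_alg \<E>\<^esub>)"] assms
    by (auto simp: S_simps \<phi>_closed)
qed

lemma pushforward_lift:
  "extension_morphism K \<E> P \<phi> (\<lambda>e. N +>\<^bsub>S\<^esub> (\<zero>\<^bsub>M\<^esub>, e)) id"
  by (auto simp: extension_morphism_def algebra_homs_iff linear_maps_iff P_simps Q_simps S_simps P_proj
      coset_incl proj_closed act_simps(5,6)[OF _ M.B.M.zero_closed] \<phi>_linear[unfolded linear_maps_iff])

text \<open>The map on \<open>S\<close> sending \<open>(m, e)\<close> to the included
  \<open>m\<close> plus \<open>\<eta> e\<close> is multiplicative, since the kernel of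
  \<open>X\<close> squares to zero and the actions on \<open>M\<close> are multiplication by
  \<open>\<eta> e\<close> in \<open>X\<close>. It kills \<open>N\<close>, since \<eta> induces
  \<phi> on the kernel, and so descends to the quotient.\<close>

lemma pushforward_universal:
  assumes X: "singular_extension K X" and X_eq: "ext_ker X = M" "ext_base X = ext_base \<E>"
    and X_act: "\<And>c m. \<lbrakk>c \<in> carrier (ext_base \<E>); m \<in> carrier M\<rbrakk> \<Longrightarrow> left_act X c m = l c m"
      "\<And>c m. \<lbrakk>c \<in> carrier (ext_base \<E>); m \<in> carrier M\<rbrakk> \<Longrightarrow> right_act X m c = r m c"
    and \<eta>: "extension_morphism K \<E> X \<phi> \<eta> id"
  shows "\<exists>h. extension_morphism K P X id h id"
proof -
  interpret X: singular_extension K X by (rule X)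
  define g where "g = (\<lambda>(m, e). ext_incl X m \<oplus>\<^bsub>ext_alg X\<^esub> \<eta> e)"
  \<comment> \<open>The value on a coset is the common value of \<open>g\<close> on its elements;
    the fact \<open>h\<close> below justifies \<open>the_elem\<close>.\<close>
  define h where "h = (\<lambda>Y. the_elem (g ` Y))"
  have \<eta>s: "\<And>e. e \<in> carrier (ext_alg \<E>) \<Longrightarrow> \<eta> e \<in> carrier (ext_alg X)"
    "\<And>e e'. \<lbrakk>e \<in> carrier (ext_alg \<E>); e' \<in> carrier (ext_alg \<E>)\<rbrakk>
      \<Longrightarrow> \<eta> (e \<oplus>\<^bsub>ext_alg \<E>\<^esub> e') = \<eta> e \<oplus>\<^bsub>ext_alg X\<^esub> \<eta> e'"
    "\<And>e e'. \<lbrakk>e \<in> carrier (ext_alg \<E>); e' \<in> carrier (ext_alg \<E>)\<rbrakk>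
      \<Longrightarrow> \<eta> (e \<otimes>\<^bsub>ext_alg \<E>\<^esub> e') = \<eta> e \<otimes>\<^bsub>ext_alg X\<^esub> \<eta> e'"
    "\<And>a e. \<lbrakk>a \<in> carrier K; e \<in> carrier (ext_alg \<E>)\<rbrakk>
      \<Longrightarrow> \<eta> (a \<odot>\<^bsub>ext_alg \<E>\<^esub> e) = a \<odot>\<^bsub>ext_alg X\<^esub> \<eta> e"
    "\<eta> \<one>\<^bsub>ext_alg \<E>\<^esub> = \<one>\<^bsub>ext_alg X\<^esub>"
    "\<And>b. b \<in> carrier (ext_ker \<E>) \<Longrightarrow> \<eta> (ext_incl \<E> b) = ext_incl X (\<phi> b)"
    "\<And>e. e \<in> carrier (ext_alg \<E>) \<Longrightarrow> ext_proj X (\<eta> e) = ext_proj \<E> e"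
    using \<eta> by (simp_all add: extension_morphism_def algebra_homs_iff linear_maps_iff)
  have \<eta>0: "\<eta> \<zero>\<^bsub>ext_alg \<E>\<^esub> = \<zero>\<^bsub>ext_alg X\<^esub>"
    using \<eta> E.module_axioms X.E.module_axioms
    by (intro linear_maps_zero) (auto simp: extension_morphism_def algebra_homs_iff)
  have k: "\<And>m. m \<in> carrier M \<Longrightarrow> ext_incl X m \<in> carrier (ext_alg X)"
    "\<And>m. m \<in> carrier M \<Longrightarrow> ext_proj X (ext_incl X m) = \<zero>\<^bsub>ext_base X\<^esub>"
    "\<And>m m'. \<lbrakk>m \<in> carrier M; m' \<in> carrier M\<rbrakk>
      \<Longrightarrow> ext_incl X (m \<oplus>\<^bsub>M\<^esub> m') = ext_incl X m \<oplus>\<^bsub>ext_alg X\<^esub> ext_incl X m'"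
    "\<And>a m. \<lbrakk>a \<in> carrier K; m \<in> carrier M\<rbrakk> \<Longrightarrow> ext_incl X (a \<odot>\<^bsub>M\<^esub> m) = a \<odot>\<^bsub>ext_alg X\<^esub> ext_incl X m"
    "\<And>m. m \<in> carrier M \<Longrightarrow> ext_incl X (\<ominus>\<^bsub>M\<^esub> m) = \<ominus>\<^bsub>ext_alg X\<^esub> ext_incl X m"
    "ext_incl X \<zero>\<^bsub>M\<^esub> = \<zero>\<^bsub>ext_alg X\<^esub>"
    "\<And>m m'. \<lbrakk>m \<in> carrier M; m' \<in> carrier M\<rbrakk>
      \<Longrightarrow> ext_incl X m \<otimes>\<^bsub>ext_alg X\<^esub> ext_incl X m' = \<zero>\<^bsub>ext_alg X\<^esub>"
    using X.incl_closed X.proj_incl X.incl_simps X.incl_zero X.square_zero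
      linear_maps_minus[OF X.incl_linear X.ker_module X.E.module_axioms]
    by (simp_all add: X_eq)
  \<comment> \<open>\<open>\<eta> e\<close> lies over the projection of \<open>e\<close>, hence may
    serve as the lift that computes the actions of \<open>X\<close>.\<close>
  have k_act: "ext_incl X (l (ext_proj \<E> e) m) = \<eta> e \<otimes>\<^bsub>ext_alg X\<^esub> ext_incl X m"
    "ext_incl X (r m (ext_proj \<E> e)) = ext_incl X m \<otimes>\<^bsub>ext_alg X\<^esub> \<eta> e"
    if "e \<in> carrier (ext_alg \<E>)" "m \<in> carrier M" for e m
    using that X.incl_left_act[of "\<eta> e" m] X.incl_right_act[of "\<eta> e" m]
      X_act[OF proj_closed[OF that(1)] that(2)]
    by (simp_all add: X_eq \<eta>s)
  have g_closed: "g x \<in> carrier (ext_alg X)" if "x \<in> carrier S" for x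
    using that by (auto simp: g_def S_simps \<eta>s k)
  have g_add: "g (x \<oplus>\<^bsub>S\<^esub> y) = g x \<oplus>\<^bsub>ext_alg X\<^esub> g y" if "x \<in> carrier S" "y \<in> carrier S" for x y
    using that by (auto simp: g_def S_simps \<eta>s k X.E.M.a_ac)
  \<comment> \<open>Of the four products, that of the two kernel elements is zero, and by
    \<open>k_act\<close> the mixed ones are the images of the two summands in the first component of
    the product in \<open>S\<close>.\<close>
  have g_mult: "g (x \<otimes>\<^bsub>S\<^esub> y) = g x \<otimes>\<^bsub>ext_alg X\<^esub> g y" if "x \<in> carrier S" "y \<in> carrier S" for x y
    using that by (auto simp: g_def S_simps \<eta>s k k_act act_simps proj_closed
        X.E.A.l_distr X.E.A.r_distr X.E.M.a_ac)
  have g_smult: "g (a \<odot>\<^bsub>S\<^esub> x) = a \<odot>\<^bsub>ext_alg X\<^esub> g x" if "a \<in> carrier K" "x \<in> carrier S" for a x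
    using that by (auto simp: g_def S_simps \<eta>s k X.E.smult_r_distr)
  have g_one: "g \<one>\<^bsub>S\<^esub> = \<one>\<^bsub>ext_alg X\<^esub>"
    by (simp add: g_def S_simps \<eta>s k)
  have g_N: "g x = \<zero>\<^bsub>ext_alg X\<^esub>" if "x \<in> N" for x
    using that by (auto simp: g_def N_def \<eta>s k \<phi>_closed X.E.M.l_neg)
  have h: "h (N +>\<^bsub>S\<^esub> x) = g x" if x: "x \<in> carrier S" for x
  proof -
    have "g ` (N +>\<^bsub>S\<^esub> x) = {g x}"
      using N.a_rcos_self[OF x] N.a_Hcarr
      by (auto simp: a_r_coset_def' g_add[OF _ x] g_N g_closed[OF x] image_iff)
    then show ?thesis by (simp add: h_def)
  qed
  have "extension_morphism K P X id h id"
    unfolding extension_morphism_def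
  proof (intro conjI ballI)
    show "id \<in> linear_maps K (ext_ker P) (ext_ker X)" "id \<in> algebra_homs K (ext_base P) (ext_base X)"
      by (simp_all add: algebra_homs_iff linear_maps_iff P_simps X_eq)
    show "h \<in> algebra_homs K (ext_alg P) (ext_alg X)"
      by (auto simp: algebra_homs_iff linear_maps_iff P_simps(2) Q_simps h g_closed g_add g_mult g_smult g_one)
    show "h (ext_incl P b) = ext_incl X (id b)" if "b \<in> carrier (ext_ker P)" for b
      using that by (simp add: P_simps h S_simps g_def k \<eta>0)
    show "ext_proj X (h e) = id (ext_proj P e)" if e: "e \<in> carrier (ext_alg P)" for e
    proof -
      obtain m d where "m \<in> carrier M" "d \<in> carrier (ext_alg \<E>)" "e = N +>\<^bsub>S\<^esub> (m, d)"
        using e by (auto simp: P_simps(2) Q_simps S_simps)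
      then show ?thesis
        by (simp add: h S_simps P_proj g_def X.proj_simps(1) k \<eta>s X_eq proj_closed)
    qed
  qed
  then show ?thesis by blast
qed

end

section \<open>Crossed homomorphisms and morphisms of extensions\<close>

text \<open>A \<open>group_action\<close> is a homomorphism into the group of extensional bijections
  of \<open>S\<close>; \<open>\<psi> g\<close> is bijective because \<open>\<psi> (inv g)\<close> is
  inverse to it.\<close>

lemma (in group) group_actionI:
  assumes closed: "\<And>g x. \<lbrakk>g \<in> carrier G; x \<in> S\<rbrakk> \<Longrightarrow> \<psi> g x \<in> S"
    and ext: "\<And>g. g \<in> carrier G \<Longrightarrow> \<psi> g \<in> extensional S"
    and one: "\<And>x. x \<in> S \<Longrightarrow> \<psi> \<one> x = x"
    and mult: "\<And>g h x. \<lbrakk>g \<in> carrier G; h \<in> carrier G; x \<in> S\<rbrakk> \<Longrightarrow> \<psi> (g \<otimes> h) x = \<psi> g (\<psi> h x)"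
  shows "group_action G S \<psi>"
proof (intro group_action.intro group_hom.intro group_hom_axioms.intro homI group_BijGroup)
  show "Group.group G" by (rule is_group)
  have Bij: "\<psi> g \<in> Bij S" if g: "g \<in> carrier G" for g
  proof -
    have "\<psi> (inv g) (\<psi> g x) = x" "\<psi> g (\<psi> (inv g) x) = x" if "x \<in> S" for x
      using g that mult[of "inv g" g x] mult[of g "inv g" x] one by simp_all
    then have "bij_betw (\<psi> g) S S"
      using closed g by (intro bij_betw_byWitness[where f' = "\<psi> (inv g)"]) auto
    then show ?thesis using ext[OF g] by (simp add: Bij_def)
  qed
  show "\<psi> g \<in> carrier (BijGroup S)" if "g \<in> carrier G" for g
    using Bij that by (simp add: BijGroup_def)
  show "\<psi> (g \<otimes> h) = \<psi> g \<otimes>\<^bsub>BijGroup S\<^esub> \<psi> h" if gh: "g \<in> carrier G" "h \<in> carrier G" for g h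
    using gh ext[of "g \<otimes> h"] mult
    by (auto simp: BijGroup_def Bij compose_def intro: extensionalityI)
qed

section \<open>The additive group of crossed homomorphisms\<close>

context bimodule
begin

lemma crossed_homs_iff:
  "\<sigma> \<in> carrier (crossed_homs K C B l r) \<longleftrightarrow> \<sigma> \<in> extensional (carrier C) \<and> \<sigma> \<in> linear_maps K C B \<and>
    (\<forall>c \<in> carrier C. \<forall>c' \<in> carrier C. \<sigma> (c \<otimes>\<^bsub>C\<^esub> c') = l c (\<sigma> c') \<oplus>\<^bsub>B\<^esub> r (\<sigma> c) c')"
  by (simp add: crossed_homs_def)

text \<open>Both actions are additive in the bimodule argument, so the cocycle identity passes to
  pointwise sums, negatives and zero.\<close>

lemma crossed_homs_group: "Group.group (crossed_homs K C B l r)"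
proof -
  let ?Z = "crossed_homs K C B l r"
  have cl: "\<lbrakk>c \<in> carrier C; b \<in> carrier B\<rbrakk> \<Longrightarrow> l c b \<in> carrier B"
    "\<lbrakk>c \<in> carrier C; b \<in> carrier B\<rbrakk> \<Longrightarrow> r b c \<in> carrier B"
    "\<lbrakk>c \<in> carrier C; b \<in> carrier B; b' \<in> carrier B\<rbrakk> \<Longrightarrow> l c (b \<oplus>\<^bsub>B\<^esub> b') = l c b \<oplus>\<^bsub>B\<^esub> l c b'"
    "\<lbrakk>c \<in> carrier C; b \<in> carrier B; b' \<in> carrier B\<rbrakk> \<Longrightarrow> r (b \<oplus>\<^bsub>B\<^esub> b') c = r b c \<oplus>\<^bsub>B\<^esub> r b' c" for c b b'
    using l_linear r_linear by (simp_all add: linear_maps_iff)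
  have zero: "c \<in> carrier C \<Longrightarrow> l c \<zero>\<^bsub>B\<^esub> = \<zero>\<^bsub>B\<^esub>" "c \<in> carrier C \<Longrightarrow> r \<zero>\<^bsub>B\<^esub> c = \<zero>\<^bsub>B\<^esub>" for c
    using linear_maps_zero[OF l_linear B.module_axioms B.module_axioms]
      linear_maps_zero[OF r_linear B.module_axioms B.module_axioms] by blast+
  have minus: "l c (\<ominus>\<^bsub>B\<^esub> b) = \<ominus>\<^bsub>B\<^esub> l c b" "r (\<ominus>\<^bsub>B\<^esub> b) c = \<ominus>\<^bsub>B\<^esub> r b c"
    if "c \<in> carrier C" "b \<in> carrier B" for c b
    using linear_maps_minus[OF l_linear[OF that(1)] B.module_axioms B.module_axioms that(2)]
      linear_maps_minus[OF r_linear[OF that(1)] B.module_axioms B.module_axioms that(2)] by auto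
  have Z: "\<sigma> c \<in> carrier B" if "\<sigma> \<in> carrier ?Z" "c \<in> carrier C" for \<sigma> c
    using that by (simp add: crossed_homs_iff linear_maps_iff)
  have m: "\<sigma> \<otimes>\<^bsub>?Z\<^esub> \<tau> = (\<lambda>c \<in> carrier C. \<sigma> c \<oplus>\<^bsub>B\<^esub> \<tau> c)" "\<one>\<^bsub>?Z\<^esub> = (\<lambda>c \<in> carrier C. \<zero>\<^bsub>B\<^esub>)" for \<sigma> \<tau>
    by (simp_all add: crossed_homs_def)
  show ?thesis
  proof (rule groupI)
    fix \<sigma> assume \<sigma>: "\<sigma> \<in> carrier ?Z"
    show "\<one>\<^bsub>?Z\<^esub> \<otimes>\<^bsub>?Z\<^esub> \<sigma> = \<sigma>"
      using \<sigma> Z[OF \<sigma>] by (intro extensionalityI[of _ "carrier C"]) (auto simp: m crossed_homs_iff)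
    let ?\<tau> = "\<lambda>c \<in> carrier C. \<ominus>\<^bsub>B\<^esub> \<sigma> c"
    have "?\<tau> \<in> carrier ?Z"
      using \<sigma> Z[OF \<sigma>]
      by (auto simp: crossed_homs_iff linear_maps_iff cl minus B.M.minus_add B.smult_r_minus)
    moreover have "?\<tau> \<otimes>\<^bsub>?Z\<^esub> \<sigma> = \<one>\<^bsub>?Z\<^esub>"
      using Z[OF \<sigma>] by (auto simp: m B.M.l_neg)
    ultimately show "\<exists>\<tau> \<in> carrier ?Z. \<tau> \<otimes>\<^bsub>?Z\<^esub> \<sigma> = \<one>\<^bsub>?Z\<^esub>" by blast
    fix \<tau> assume \<tau>: "\<tau> \<in> carrier ?Z"
    show "\<sigma> \<otimes>\<^bsub>?Z\<^esub> \<tau> \<in> carrier ?Z"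
      using \<sigma> \<tau> Z[OF \<sigma>] Z[OF \<tau>]
      by (simp add: m crossed_homs_iff linear_maps_iff cl B.M.a_ac B.smult_r_distr)
    fix \<rho> assume \<rho>: "\<rho> \<in> carrier ?Z"
    show "\<sigma> \<otimes>\<^bsub>?Z\<^esub> \<tau> \<otimes>\<^bsub>?Z\<^esub> \<rho> = \<sigma> \<otimes>\<^bsub>?Z\<^esub> (\<tau> \<otimes>\<^bsub>?Z\<^esub> \<rho>)"
      using Z[OF \<sigma>] Z[OF \<tau>] Z[OF \<rho>] by (auto simp: m B.M.a_assoc)
  next
    show "\<one>\<^bsub>?Z\<^esub> \<in> carrier ?Z"
      by (simp add: m crossed_homs_iff linear_maps_iff zero)
  qed
qed

end

section \<open>Comparison of the push forward with the pullback for given outer components\<close>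

locale extension_pair = X: singular_extension K \<E> + Y: singular_extension K \<E>'
  for K :: "('k, 'n) ring_scheme" (structure)
    and \<E> :: "('k, 'b, 'e, 'c) extension" and \<E>' :: "('k, 'a, 'f, 'd) extension" +
  fixes \<phi>\<^sub>0 :: "'c \<Rightarrow> 'd" and \<phi>\<^sub>1 :: "'b \<Rightarrow> 'a"
  assumes morphism: "bimodule_morphism K
      (ext_base \<E>) (ext_ker \<E>) (left_act \<E>) (right_act \<E>)
      (ext_base \<E>') (ext_ker \<E>') (left_act \<E>') (right_act \<E>') \<phi>\<^sub>0 \<phi>\<^sub>1"
begin

abbreviation "lact \<equiv> \<lambda>c b. left_act \<E>' (\<phi>\<^sub>0 c) b"
abbreviation "ract \<equiv> \<lambda>b c. right_act \<E>' b (\<phi>\<^sub>0 c)"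
abbreviation "Z \<equiv> crossed_homs K (ext_base \<E>) (ext_ker \<E>') lact ract"
abbreviation "morphisms \<equiv> OPEXT K \<phi>\<^sub>0 \<phi>\<^sub>1 \<E> \<E>'"
abbreviation "act \<equiv> crossed_homs_act K \<phi>\<^sub>0 \<phi>\<^sub>1 \<E> \<E>'"
abbreviation "pull \<equiv> pullback_extension (ext_base \<E>) \<phi>\<^sub>0 \<E>'"
abbreviation "push \<equiv> pushforward_extension (ext_ker \<E>') lact ract \<phi>\<^sub>1 \<E>"

lemma \<phi>\<^sub>0_hom: "\<phi>\<^sub>0 \<in> algebra_homs K (ext_base \<E>) (ext_base \<E>')"
  and \<phi>\<^sub>1_linear: "\<phi>\<^sub>1 \<in> linear_maps K (ext_ker \<E>) (ext_ker \<E>')"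
  using morphism by (simp_all add: bimodule_morphism_def)

lemma \<phi>\<^sub>1_closed: "b \<in> carrier (ext_ker \<E>) \<Longrightarrow> \<phi>\<^sub>1 b \<in> carrier (ext_ker \<E>')"
  using \<phi>\<^sub>1_linear by (simp add: linear_maps_iff)

sublocale bim: bimodule K "ext_base \<E>" "ext_ker \<E>'" lact ract
  by (rule bimodule_restrict_scalars[OF Y.induced_bimodule X.base_algebra \<phi>\<^sub>0_hom])

text \<open>Compatibility of \<open>\<phi>\<^sub>1\<close> with the actions along
  \<open>\<phi>\<^sub>0\<close> says that \<open>\<phi>\<^sub>1\<close> is a map of
  \<open>C\<close>-bimodules into the restricted \<open>B'\<close>.\<close>

sublocale F: pushforward K \<E> "ext_ker \<E>'" lact ract \<phi>\<^sub>1
  using morphism by unfold_locales (auto simp: bimodule_morphism_def)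

lemma pull_singular: "singular_extension K pull"
  by (rule Y.pullback_singular[OF X.base_algebra \<phi>\<^sub>0_hom])

lemma morphism_iff_equivalent:
  "(\<exists>\<epsilon>. extension_morphism K \<E> \<E>' \<phi>\<^sub>1 \<epsilon> \<phi>\<^sub>0) \<longleftrightarrow> equivalent_extensions K pull push"
proof
  assume "\<exists>\<epsilon>. extension_morphism K \<E> \<E>' \<phi>\<^sub>1 \<epsilon> \<phi>\<^sub>0"
  then obtain \<epsilon> where "extension_morphism K \<E> \<E>' \<phi>\<^sub>1 \<epsilon> \<phi>\<^sub>0" ..
  \<comment> \<open>First \<open>pullback_universal\<close> makes \<epsilon> a morphism to
    \<open>pull\<close> over the identity, then \<open>pushforward_universal\<close> turns it into a
    map out of \<open>push\<close>; the requirement on the actions is met by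
    \<open>pullback_act\<close>.\<close>
  then have "\<exists>h. extension_morphism K push pull id h id"
    by (intro F.pushforward_universal[OF pull_singular _ _ _ _
        pullback_universal[OF X.singular_extension_axioms]])
      (simp_all add: pullback_extension_simps
        pullback_act[OF Y.singular_extension_axioms X.base_algebra \<phi>\<^sub>0_hom])
  then obtain h where h: "extension_morphism K push pull id h id" ..
  have "bij_betw h (carrier (ext_alg push)) (carrier (ext_alg pull))"
    by (rule short_five[OF F.P.singular_extension_axioms pull_singular h])
      (simp_all add: F.P_simps pullback_extension_simps)
  then have "equivalent_extensions K push pull"
    using h by (auto simp: equivalent_extensions_def F.P_simps pullback_extension_simps)
  then show "equivalent_extensions K pull push"
    by (rule equivalent_extensions_sym[OF F.P.singular_extension_axioms pull_singular])
next
  assume "equivalent_extensions K pull push"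
  then have "equivalent_extensions K push pull"
    by (rule equivalent_extensions_sym[OF pull_singular F.P.singular_extension_axioms])
  then obtain h where "extension_morphism K push pull id h id"
    by (auto simp: equivalent_extensions_def)
  \<comment> \<open>The composite from \<open>\<E>\<close> through \<open>push\<close> and
    \<open>pull\<close> to \<open>\<E>'\<close>. The first map contributes
    \<open>\<phi>\<^sub>1\<close> and the last \<open>\<phi>\<^sub>0\<close>; all other outer
    components are identities.\<close>
  from extension_morphism_comp[OF pullback_projection[OF \<phi>\<^sub>0_hom]
      extension_morphism_comp[OF this F.pushforward_lift]]
  show "\<exists>\<epsilon>. extension_morphism K \<E> \<E>' \<phi>\<^sub>1 \<epsilon> \<phi>\<^sub>0" by auto
qed

section \<open>The action of crossed homomorphisms on the morphisms of extensions\<close>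

lemma morphisms_simps:
  assumes "\<epsilon> \<in> morphisms"
  shows "e \<in> carrier (ext_alg \<E>) \<Longrightarrow> \<epsilon> e \<in> carrier (ext_alg \<E>')"
    "\<lbrakk>e \<in> carrier (ext_alg \<E>); e' \<in> carrier (ext_alg \<E>)\<rbrakk>
      \<Longrightarrow> \<epsilon> (e \<oplus>\<^bsub>ext_alg \<E>\<^esub> e') = \<epsilon> e \<oplus>\<^bsub>ext_alg \<E>'\<^esub> \<epsilon> e'"
    "\<lbrakk>e \<in> carrier (ext_alg \<E>); e' \<in> carrier (ext_alg \<E>)\<rbrakk>
      \<Longrightarrow> \<epsilon> (e \<otimes>\<^bsub>ext_alg \<E>\<^esub> e') = \<epsilon> e \<otimes>\<^bsub>ext_alg \<E>'\<^esub> \<epsilon> e'"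
    "\<lbrakk>a \<in> carrier K; e \<in> carrier (ext_alg \<E>)\<rbrakk>
      \<Longrightarrow> \<epsilon> (a \<odot>\<^bsub>ext_alg \<E>\<^esub> e) = a \<odot>\<^bsub>ext_alg \<E>'\<^esub> \<epsilon> e"
    "\<epsilon> \<one>\<^bsub>ext_alg \<E>\<^esub> = \<one>\<^bsub>ext_alg \<E>'\<^esub>"
    "b \<in> carrier (ext_ker \<E>) \<Longrightarrow> \<epsilon> (ext_incl \<E> b) = ext_incl \<E>' (\<phi>\<^sub>1 b)"
    "e \<in> carrier (ext_alg \<E>) \<Longrightarrow> \<phi>\<^sub>0 (ext_proj \<E> e) = ext_proj \<E>' (\<epsilon> e)"
  \<comment> \<open>The last rule replaces \<open>\<phi>\<^sub>0\<close> of a projection by a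
    projection in \<open>\<E>'\<close>, so that \<open>lact\<close> and \<open>ract\<close> can be
    computed with \<open>\<epsilon> e\<close> as a lift.\<close>
  using assms by (simp_all add: OPEXT_def extension_morphism_def algebra_homs_iff linear_maps_iff)

lemma Z_simps:
  assumes "\<sigma> \<in> carrier Z"
  shows "c \<in> carrier (ext_base \<E>) \<Longrightarrow> \<sigma> c \<in> carrier (ext_ker \<E>')"
    "\<lbrakk>c \<in> carrier (ext_base \<E>); c' \<in> carrier (ext_base \<E>)\<rbrakk>
      \<Longrightarrow> \<sigma> (c \<oplus>\<^bsub>ext_base \<E>\<^esub> c') = \<sigma> c \<oplus>\<^bsub>ext_ker \<E>'\<^esub> \<sigma> c'"
    "\<lbrakk>a \<in> carrier K; c \<in> carrier (ext_base \<E>)\<rbrakk>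
      \<Longrightarrow> \<sigma> (a \<odot>\<^bsub>ext_base \<E>\<^esub> c) = a \<odot>\<^bsub>ext_ker \<E>'\<^esub> \<sigma> c"
    "\<lbrakk>c \<in> carrier (ext_base \<E>); c' \<in> carrier (ext_base \<E>)\<rbrakk>
      \<Longrightarrow> \<sigma> (c \<otimes>\<^bsub>ext_base \<E>\<^esub> c') = lact c (\<sigma> c') \<oplus>\<^bsub>ext_ker \<E>'\<^esub> ract (\<sigma> c) c'"
    "\<sigma> \<zero>\<^bsub>ext_base \<E>\<^esub> = \<zero>\<^bsub>ext_ker \<E>'\<^esub>"
    "\<sigma> \<one>\<^bsub>ext_base \<E>\<^esub> = \<zero>\<^bsub>ext_ker \<E>'\<^esub>"
proof -
  show zero: "\<sigma> \<zero>\<^bsub>ext_base \<E>\<^esub> = \<zero>\<^bsub>ext_ker \<E>'\<^esub>"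
    using assms linear_maps_zero[OF _ X.C.module_axioms Y.ker_module] by (simp add: bim.crossed_homs_iff)
  show "\<sigma> c \<in> carrier (ext_ker \<E>')" if "c \<in> carrier (ext_base \<E>)" for c
    using assms that by (simp add: bim.crossed_homs_iff linear_maps_iff)
  then have one: "\<sigma> \<one>\<^bsub>ext_base \<E>\<^esub> \<in> carrier (ext_ker \<E>')" by simp
  \<comment> \<open>As the actions are unital, the cocycle identity at the product of one with
    itself says that the value at one equals its own double.\<close>
  have "\<sigma> (\<one>\<^bsub>ext_base \<E>\<^esub> \<otimes>\<^bsub>ext_base \<E>\<^esub> \<one>\<^bsub>ext_base \<E>\<^esub>) = \<sigma> \<one>\<^bsub>ext_base \<E>\<^esub> \<oplus>\<^bsub>ext_ker \<E>'\<^esub> \<sigma> \<one>\<^bsub>ext_base \<E>\<^esub>"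
    using assms bim.l_one[OF one] bim.r_one[OF one] unfolding bim.crossed_homs_iff
    by (metis X.C.A.one_closed)
  then show "\<sigma> \<one>\<^bsub>ext_base \<E>\<^esub> = \<zero>\<^bsub>ext_ker \<E>'\<^esub>" using one by simp
qed (use assms in \<open>simp_all add: bim.crossed_homs_iff linear_maps_iff\<close>)

lemma act_apply:
  "\<lbrakk>\<epsilon> \<in> morphisms; e \<in> carrier (ext_alg \<E>)\<rbrakk>
    \<Longrightarrow> act \<sigma> \<epsilon> e = ext_incl \<E>' (\<sigma> (ext_proj \<E> e)) \<oplus>\<^bsub>ext_alg \<E>'\<^esub> \<epsilon> e"
  by (simp add: crossed_homs_act_def)

text \<open>In a product, the kernel terms multiply to zero and the mixed terms are the two terms of
  the cocycle identity. The values at the unit and on the included kernel are unchanged because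
  \<sigma> vanishes at one and at zero, and the projection is unchanged because kernel elements
  project to zero.\<close>

lemma act_closed:
  assumes \<sigma>: "\<sigma> \<in> carrier Z" and \<epsilon>: "\<epsilon> \<in> morphisms"
  shows "act \<sigma> \<epsilon> \<in> morphisms"
proof -
  have ext: "act \<sigma> \<epsilon> \<in> extensional (carrier (ext_alg \<E>))"
    using \<epsilon> by (simp add: crossed_homs_act_def)
  have \<sigma>_cl: "\<sigma> (ext_proj \<E> e) \<in> carrier (ext_ker \<E>')" if "e \<in> carrier (ext_alg \<E>)" for e
    using that by (simp add: Z_simps[OF \<sigma>] X.proj_closed)
  note s = act_apply[OF \<epsilon>] Z_simps(2-)[OF \<sigma>] \<sigma>_cl morphisms_simps[OF \<epsilon>] X.proj_closed
    X.proj_simps(1,2,4) X.proj_one X.proj_incl X.incl_closed Y.incl_closed Y.incl_simps(1) Y.incl_smult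
    Y.incl_zero Y.proj_simps(1) Y.proj_incl Y.proj_closed \<phi>\<^sub>1_closed
  have "act \<sigma> \<epsilon> \<in> linear_maps K (ext_alg \<E>) (ext_alg \<E>')"
    by (simp add: linear_maps_iff s Y.E.M.a_ac Y.E.smult_r_distr)
  moreover have "act \<sigma> \<epsilon> (e \<otimes>\<^bsub>ext_alg \<E>\<^esub> e') = act \<sigma> \<epsilon> e \<otimes>\<^bsub>ext_alg \<E>'\<^esub> act \<sigma> \<epsilon> e'"
    if "e \<in> carrier (ext_alg \<E>)" "e' \<in> carrier (ext_alg \<E>)" for e e'
    using that by (simp add: s Y.left_act_closed Y.right_act_closed Y.incl_left_act Y.incl_right_act
        Y.E.A.l_distr Y.E.A.r_distr Y.square_zero Y.E.M.a_ac)
  moreover have "act \<sigma> \<epsilon> \<one>\<^bsub>ext_alg \<E>\<^esub> = \<one>\<^bsub>ext_alg \<E>'\<^esub>"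
    by (simp add: s)
  ultimately have "act \<sigma> \<epsilon> \<in> algebra_homs K (ext_alg \<E>) (ext_alg \<E>')"
    by (simp add: algebra_homs_iff)
  then show ?thesis
    by (simp add: OPEXT_def extension_morphism_def ext \<phi>\<^sub>0_hom \<phi>\<^sub>1_linear)
      (simp add: s)
qed

lemma act_group_action: "group_action Z morphisms act"
proof (rule group.group_actionI[OF bim.crossed_homs_group])
  fix \<sigma> \<epsilon> assume \<sigma>: "\<sigma> \<in> carrier Z" and \<epsilon>: "\<epsilon> \<in> morphisms"
  show cl: "act \<sigma> \<epsilon> \<in> morphisms" by (rule act_closed[OF \<sigma> \<epsilon>])
  fix \<tau> assume \<tau>: "\<tau> \<in> carrier Z"
  have "act (\<tau> \<otimes>\<^bsub>Z\<^esub> \<sigma>) \<epsilon> e = act \<tau> (act \<sigma> \<epsilon>) e" if "e \<in> carrier (ext_alg \<E>)" for e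
    using that Z_simps(1)[OF \<sigma> X.proj_closed[OF that]] Z_simps(1)[OF \<tau> X.proj_closed[OF that]]
    by (simp add: act_apply \<epsilon> cl crossed_homs_def X.proj_closed Y.incl_simps(1) Y.incl_closed
        morphisms_simps(1)[OF \<epsilon>] Y.E.M.a_assoc)
  then show "act (\<tau> \<otimes>\<^bsub>Z\<^esub> \<sigma>) \<epsilon> = act \<tau> (act \<sigma> \<epsilon>)"
    using \<epsilon> cl by (intro extensionalityI[of _ "carrier (ext_alg \<E>)"]) (simp_all add: crossed_homs_act_def)
next
  fix \<epsilon> assume \<epsilon>: "\<epsilon> \<in> morphisms"
  have "act \<one>\<^bsub>Z\<^esub> \<epsilon> e = \<epsilon> e" if "e \<in> carrier (ext_alg \<E>)" for e
    using that by (simp add: act_apply \<epsilon> crossed_homs_def X.proj_closed Y.incl_zero morphisms_simps(1)[OF \<epsilon>])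
  then show "act \<one>\<^bsub>Z\<^esub> \<epsilon> = \<epsilon>"
    using \<epsilon> by (intro extensionalityI[of _ "carrier (ext_alg \<E>)"])
      (simp_all add: crossed_homs_act_def, simp_all add: OPEXT_def)
qed (simp add: crossed_homs_act_def)

lemma act_difference:
  assumes \<epsilon>: "\<epsilon> \<in> morphisms" and \<delta>: "\<delta> \<in> morphisms"
  shows "\<exists>!\<sigma>. \<sigma> \<in> carrier Z \<and> act \<sigma> \<epsilon> = \<delta>"
proof -
  \<comment> \<open>The rule for \<open>\<phi>\<^sub>0\<close> is left out, as its instances for
    \<epsilon> and \<delta> would rewrite the same term differently; the cocycle step below picks
    \<epsilon> as the lift.\<close>
  note s = morphisms_simps(1-6)[OF \<epsilon>] morphisms_simps(1-6)[OF \<delta>]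
  have cancel: "b = b'"
    if "e \<in> carrier (ext_alg \<E>)" "b \<in> carrier (ext_ker \<E>')" "b' \<in> carrier (ext_ker \<E>')"
      "ext_incl \<E>' b \<oplus>\<^bsub>ext_alg \<E>'\<^esub> \<epsilon> e = ext_incl \<E>' b' \<oplus>\<^bsub>ext_alg \<E>'\<^esub> \<epsilon> e" for e b b'
    using that by (intro Y.ker_eqI) (simp_all add: s Y.incl_closed)
  \<comment> \<open>Existence of the value at \<open>c\<close>: one lift \<open>e\<close> yields
    \<open>b\<close>, and any other lift differs from \<open>e\<close> by an included kernel
    element, on which \<epsilon> and \<delta> agree.\<close>
  have "\<exists>b \<in> carrier (ext_ker \<E>'). \<forall>e \<in> carrier (ext_alg \<E>). ext_proj \<E> e = c
      \<longrightarrow> \<delta> e = ext_incl \<E>' b \<oplus>\<^bsub>ext_alg \<E>'\<^esub> \<epsilon> e" if c: "c \<in> carrier (ext_base \<E>)" for c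
  proof -
    obtain e where e: "e \<in> carrier (ext_alg \<E>)" "c = ext_proj \<E> e" using c by (rule X.base_elem)
    have "ext_proj \<E>' (\<epsilon> e) = ext_proj \<E>' (\<delta> e)"
      using e(1) morphisms_simps(7)[OF \<epsilon>] morphisms_simps(7)[OF \<delta>] by simp
    then obtain b where b: "b \<in> carrier (ext_ker \<E>')" "\<delta> e = \<epsilon> e \<oplus>\<^bsub>ext_alg \<E>'\<^esub> ext_incl \<E>' b"
      using Y.same_proj e(1) s by metis
    have "\<delta> d = ext_incl \<E>' b \<oplus>\<^bsub>ext_alg \<E>'\<^esub> \<epsilon> d" if d: "d \<in> carrier (ext_alg \<E>)" "ext_proj \<E> d = c" for d
    proof -
      obtain x where "x \<in> carrier (ext_ker \<E>)" "d = e \<oplus>\<^bsub>ext_alg \<E>\<^esub> ext_incl \<E> x"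
        using X.same_proj[OF e(1) d(1)] e(2) d(2) by metis
      then show ?thesis
        using b e(1) by (simp add: s X.incl_closed Y.incl_closed \<phi>\<^sub>1_closed Y.E.M.a_ac)
    qed
    then show ?thesis using b(1) by blast
  qed
  then obtain \<sigma>' where \<sigma>': "\<And>c. c \<in> carrier (ext_base \<E>) \<Longrightarrow> \<sigma>' c \<in> carrier (ext_ker \<E>') \<and>
      (\<forall>e \<in> carrier (ext_alg \<E>). ext_proj \<E> e = c \<longrightarrow> \<delta> e = ext_incl \<E>' (\<sigma>' c) \<oplus>\<^bsub>ext_alg \<E>'\<^esub> \<epsilon> e)"
    by metis
  define \<sigma> where "\<sigma> = restrict \<sigma>' (carrier (ext_base \<E>))"
  have \<sigma>: "\<sigma> (ext_proj \<E> e) \<in> carrier (ext_ker \<E>')"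
    "\<delta> e = ext_incl \<E>' (\<sigma> (ext_proj \<E> e)) \<oplus>\<^bsub>ext_alg \<E>'\<^esub> \<epsilon> e" if "e \<in> carrier (ext_alg \<E>)" for e
    using \<sigma>'[OF X.proj_closed[OF that]] that X.proj_closed[OF that] by (auto simp: \<sigma>_def)
  \<comment> \<open>The value of \<sigma> at a projection is identified by any kernel element
    solving the defining equation there; linearity, the cocycle identity and uniqueness all reduce
    to this.\<close>
  have \<sigma>_eq: "\<sigma> (ext_proj \<E> e) = b"
    if "e \<in> carrier (ext_alg \<E>)" "b \<in> carrier (ext_ker \<E>')"
      "\<delta> e = ext_incl \<E>' b \<oplus>\<^bsub>ext_alg \<E>'\<^esub> \<epsilon> e" for e b
    using cancel[OF that(1) \<sigma>(1)[OF that(1)] that(2)] \<sigma>(2)[OF that(1)] that(3) by simp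
  have "\<sigma> \<in> linear_maps K (ext_base \<E>) (ext_ker \<E>')"
    unfolding linear_maps_iff X.base_ball
  proof (intro conjI ballI)
    fix e assume e: "e \<in> carrier (ext_alg \<E>)"
    show "\<sigma> (ext_proj \<E> e) \<in> carrier (ext_ker \<E>')" by (rule \<sigma>(1)[OF e])
    show "\<sigma> (ext_proj \<E> e \<oplus>\<^bsub>ext_base \<E>\<^esub> ext_proj \<E> d) = \<sigma> (ext_proj \<E> e) \<oplus>\<^bsub>ext_ker \<E>'\<^esub> \<sigma> (ext_proj \<E> d)"
      if d: "d \<in> carrier (ext_alg \<E>)" for d
      unfolding X.proj_simps(1)[OF e d, symmetric]
      using e d \<sigma>(1)[OF e] \<sigma>(1)[OF d] s
      by (intro \<sigma>_eq)
        (simp_all add: \<sigma>(2)[OF e] \<sigma>(2)[OF d] Y.incl_simps(1) Y.incl_closed Y.E.M.a_ac)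
    show "\<sigma> (a \<odot>\<^bsub>ext_base \<E>\<^esub> ext_proj \<E> e) = a \<odot>\<^bsub>ext_ker \<E>'\<^esub> \<sigma> (ext_proj \<E> e)" if a: "a \<in> carrier K" for a
      unfolding X.proj_simps(4)[OF e e a, symmetric]
      using e a \<sigma>(1)[OF e] s
      by (intro \<sigma>_eq)
        (simp_all add: \<sigma>(2)[OF e] Y.incl_smult Y.incl_closed Y.E.smult_r_distr)
  qed
  moreover have "\<sigma> (ext_proj \<E> e \<otimes>\<^bsub>ext_base \<E>\<^esub> ext_proj \<E> d) =
      lact (ext_proj \<E> e) (\<sigma> (ext_proj \<E> d)) \<oplus>\<^bsub>ext_ker \<E>'\<^esub> ract (\<sigma> (ext_proj \<E> e)) (ext_proj \<E> d)"
    if e: "e \<in> carrier (ext_alg \<E>)" and d: "d \<in> carrier (ext_alg \<E>)" for e d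
    \<comment> \<open>With the argument written as the projection of the product of lifts,
      \<open>\<sigma>_eq\<close> asks to expand \<open>\<delta> e\<close> times
      \<open>\<delta> d\<close>: the kernel terms multiply to zero and the mixed terms are the two
      actions.\<close>
    unfolding X.proj_simps(2)[OF e d, symmetric]
    using e d \<sigma>(1)[OF e] \<sigma>(1)[OF d] s
    by (intro \<sigma>_eq) (simp_all add: \<sigma>(2)[OF e] \<sigma>(2)[OF d] morphisms_simps(7)[OF \<epsilon>] Y.left_act_closed
        Y.right_act_closed Y.incl_left_act Y.incl_right_act Y.incl_simps(1) Y.incl_closed
        Y.E.A.l_distr Y.E.A.r_distr Y.square_zero Y.E.M.a_ac)
  moreover have "\<sigma> \<in> extensional (carrier (ext_base \<E>))"
    by (simp add: \<sigma>_def)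
  ultimately have Z: "\<sigma> \<in> carrier Z"
    by (simp add: bim.crossed_homs_iff X.base_ball)
  show ?thesis
  proof (rule ex1I[of _ \<sigma>], intro conjI)
    show "\<sigma> \<in> carrier Z" by (rule Z)
    show "act \<sigma> \<epsilon> = \<delta>"
      using act_closed[OF Z \<epsilon>] \<delta>
      by (intro extensionalityI[of _ "carrier (ext_alg \<E>)"])
        (simp_all add: act_apply \<epsilon> \<sigma>(2), simp_all add: OPEXT_def)
    fix \<tau> assume \<tau>: "\<tau> \<in> carrier Z \<and> act \<tau> \<epsilon> = \<delta>"
    have "\<sigma> (ext_proj \<E> e) = \<tau> (ext_proj \<E> e)" if e: "e \<in> carrier (ext_alg \<E>)" for e
      using \<tau> act_apply[OF \<epsilon> e, of \<tau>] Z_simps(1)[OF _ X.proj_closed[OF e]] by (intro \<sigma>_eq[OF e]) auto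
    then have "\<forall>c \<in> carrier (ext_base \<E>). \<tau> c = \<sigma> c" unfolding X.base_ball by simp
    then show "\<tau> = \<sigma>"
      using \<tau> Z by (intro extensionalityI[of _ "carrier (ext_base \<E>)"]) (auto simp: bim.crossed_homs_iff)
  qed
qed

end

theorem theorem4p5:
  fixes K :: "('k, 'n) ring_scheme"
    and \<E> :: "('k, 'b, 'e, 'c) extension"
    and \<E>' :: "('k, 'a, 'f, 'd) extension"
    and \<phi>\<^sub>0 :: "'c \<Rightarrow> 'd"
    and \<phi>\<^sub>1 :: "'b \<Rightarrow> 'a"
  assumes "singular_extension K \<E>"
    and "singular_extension K \<E>'"
    and "bimodule_morphism K
      (ext_base \<E>) (ext_ker \<E>) (left_act \<E>) (right_act \<E>)
      (ext_base \<E>') (ext_ker \<E>') (left_act \<E>') (right_act \<E>') \<phi>\<^sub>0 \<phi>\<^sub>1"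
  shows "((\<exists>\<epsilon>. extension_morphism K \<E> \<E>' \<phi>\<^sub>1 \<epsilon> \<phi>\<^sub>0) \<longleftrightarrow>
      equivalent_extensions K
        (pullback_extension (ext_base \<E>) \<phi>\<^sub>0 \<E>')
        (pushforward_extension (ext_ker \<E>')
          (\<lambda>c b. left_act \<E>' (\<phi>\<^sub>0 c) b) (\<lambda>b c. right_act \<E>' b (\<phi>\<^sub>0 c)) \<phi>\<^sub>1 \<E>))
    \<and> ((\<exists>\<epsilon>. extension_morphism K \<E> \<E>' \<phi>\<^sub>1 \<epsilon> \<phi>\<^sub>0) \<longrightarrow>
      simply_transitive_action
        (crossed_homs K (ext_base \<E>) (ext_ker \<E>')
          (\<lambda>c b. left_act \<E>' (\<phi>\<^sub>0 c) b) (\<lambda>b c. right_act \<E>' b (\<phi>\<^sub>0 c)))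
        (OPEXT K \<phi>\<^sub>0 \<phi>\<^sub>1 \<E> \<E>')
        (crossed_homs_act K \<phi>\<^sub>0 \<phi>\<^sub>1 \<E> \<E>'))"
proof -
  interpret extension_pair K \<E> \<E>' \<phi>\<^sub>0 \<phi>\<^sub>1
    using assms by (intro extension_pair.intro extension_pair_axioms.intro)
  show ?thesis
    using morphism_iff_equivalent act_group_action act_difference
    unfolding simply_transitive_action_def by blast
qed

end
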